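(* Let $t$ be a prime power and $d$ be an integer such that $0\le d<\lceil 2t^2/3\rceil$. There exists an optimal $t$-TS$(t^2+d+1,\ t^{2n}+t^{2(n-1)}+\cdots+t^2+d+1)$ for every integer $n\ge 2+\min\{2,d\}$.
   Context: A set system is a pair $(\mathcal{X},\mathcal{B})$ where $\mathcal{X}$ is a finite set of points and $\mathcal{B}$ is a collection (set) of subsets of $\mathcal{X}$ called blocks; its size is $|\mathcal{B}|$. $\binom{\mathcal{X}}{w}$ denotes the collection of all $w$-subsets of $\mathcal{X}$. A $t$-traceability scheme $t$-TS$(w,v)$ is a set system $(\mathcal{X},\mathcal{B})$ with $|\mathcal{X}|=v$ and $\mathcal{B}\subseteq\binom{\mathcal{X}}{w}$ such that for every choice of $s$ blocks $B_1,\ldots,B_s\in\mathcal{B}$ with $1\le s\le t$ and for any $w$-subset $T\subseteq\bigcup_{1\le j\le s}B_j$, there does not exist a block $B\in\mathcal{B}\setminus\{B_1,\ldots,B_s\}$ such that $|T\cap B|\ge|T\cap B_j|$ for all $1\le j\le s$. $M_t(w,v)$ denotes the maximum size of a $t$-TS$(w,v)$. In this paper, a $t$-TS$(w,v)$ is called optimal if it has size $M_t(w,v)$; the optimal schemes asserted here are those whose size equals the upper bound $\binom{v-d}{\lceil w/t^2\rceil}/\binom{w-d}{\lceil w/t^2\rceil}$ on $M_t(w,v)$, where $w=t^2+d+1$ and $v=t^{2n}+t^{2(n-1)}+\cdots+t^2+d+1$. *)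

theory Defs
  imports Complex_Main "HOL-Library.Ramsey" "HOL-Number_Theory.Prime_Powers"
begin

text \<open>The notation \<open>[X]\<^bsup>w\<^esup>\<close> (\<^const>\<open>nsets\<close>) is the library's collection of all
  \<open>w\<close>-subsets of \<open>X\<close>.  Choosing \<open>s\<close> blocks with \<open>1 \<le> s \<le> t\<close> is rendered as choosing a nonempty
  set \<open>S\<close> of at most \<open>t\<close> blocks: the condition on \<open>B\<^sub>1, \<dots>, B\<^sub>s\<close> depends only on the set
  of these blocks, so repetitions among them would make no difference.\<close>

definition traceability_scheme ::
    "nat \<Rightarrow> nat \<Rightarrow> nat \<Rightarrow> 'a set \<Rightarrow> 'a set set \<Rightarrow> bool" where
  "traceability_scheme t w v X \<B> \<longleftrightarrow>
     finite X \<and> card X = v \<and> \<B> \<subseteq> [X]\<^bsup>w\<^esup> \<and>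
     (\<forall>S T. S \<subseteq> \<B> \<and> 1 \<le> card S \<and> card S \<le> t \<and> T \<in> [\<Union>S]\<^bsup>w\<^esup> \<longrightarrow>
        \<not> (\<exists>B \<in> \<B> - S. \<forall>B' \<in> S. card (T \<inter> B) \<ge> card (T \<inter> B')))"

text \<open>The points are taken in the type \<^typ>\<open>nat\<close>, which loses nothing: see
  \<open>traceability_scheme_card_le\<close> below.  The maximum is over a finite nonempty set
  (\<open>max_TS_size_set\<close>).\<close>

definition max_TS_size :: "nat \<Rightarrow> nat \<Rightarrow> nat \<Rightarrow> nat" where
  "max_TS_size t w v =
     Max {card \<B> | \<B>. \<exists>X :: nat set. traceability_scheme t w v X \<B>}"

definition optimal_TS ::
    "nat \<Rightarrow> nat \<Rightarrow> nat \<Rightarrow> 'a set \<Rightarrow> 'a set set \<Rightarrow> bool" where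
  "optimal_TS t w v X \<B> \<longleftrightarrow>
     traceability_scheme t w v X \<B> \<and> card \<B> = max_TS_size t w v"

lemma max_TS_size_set:
  "finite {card \<B> | \<B>. \<exists>X :: nat set. traceability_scheme t w v X \<B>}"
  "{card \<B> | \<B>. \<exists>X :: nat set. traceability_scheme t w v X \<B>} \<noteq> {}"
proof -
  have "card \<B> \<le> 2 ^ v" if "traceability_scheme t w v X \<B>" for X :: "nat set" and \<B>
  proof -
    have "finite X" "card X = v" "\<B> \<subseteq> Pow X"
      using that by (auto simp: traceability_scheme_def nsets_def)
    then show ?thesis
      by (metis card_Pow card_mono finite_Pow_iff)
  qed
  then have "{card \<B> | \<B>. \<exists>X :: nat set. traceability_scheme t w v X \<B>} \<subseteq> {..2 ^ v}"
    by blast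
  then show "finite {card \<B> | \<B>. \<exists>X :: nat set. traceability_scheme t w v X \<B>}"
    by (rule finite_subset) simp
  have "traceability_scheme t w v {..<v} {}"
    by (simp add: traceability_scheme_def)
  then show "{card \<B> | \<B>. \<exists>X :: nat set. traceability_scheme t w v X \<B>} \<noteq> {}"
    by blast
qed

lemma traceability_scheme_image:
  assumes TS: "traceability_scheme t w v X \<B>" and f: "inj_on f X"
  shows "traceability_scheme t w v (f ` X) ((`) f ` \<B>)" "card ((`) f ` \<B>) = card \<B>"
proof -
  have X: "finite X" "card X = v" "\<B> \<subseteq> [X]\<^bsup>w\<^esup>"
    using TS by (auto simp: traceability_scheme_def)
  have BX: "\<B> \<subseteq> Pow X" using X(3) by (auto simp: nsets_def)
  have inj: "inj_on ((`) f) \<B>"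
    using inj_on_image_Pow[OF f] BX by (rule inj_on_subset)
  then show "card ((`) f ` \<B>) = card \<B>" by (rule card_image)
  show "traceability_scheme t w v (f ` X) ((`) f ` \<B>)"
    unfolding traceability_scheme_def
  proof (intro conjI allI impI)
    show "finite (f ` X)" using X by simp
    show "card (f ` X) = v" using X f by (simp add: card_image)
    show "(`) f ` \<B> \<subseteq> [f ` X]\<^bsup>w\<^esup>"
    proof
      fix C assume "C \<in> (`) f ` \<B>"
      then obtain B where B: "B \<in> \<B>" "C = f ` B" by auto
      then have "B \<subseteq> X" "finite B" "card B = w" using X(3) by (auto simp: nsets_def)
      with B f show "C \<in> [f ` X]\<^bsup>w\<^esup>"
        by (auto simp: nsets_def card_image inj_on_subset)
    qed
    fix S T
    assume ST: "S \<subseteq> (`) f ` \<B> \<and> 1 \<le> card S \<and> card S \<le> t \<and> T \<in> [\<Union>S]\<^bsup>w\<^esup>"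
    then obtain S0 where S0: "S0 \<subseteq> \<B>" "S = (`) f ` S0"
      by (auto simp: subset_image_iff)
    have cS: "card S = card S0"
      unfolding S0 by (rule card_image) (rule inj_on_subset[OF inj S0(1)])
    have "\<Union>S = f ` \<Union>S0" using S0 by auto
    then have "T \<subseteq> f ` \<Union>S0" using ST by (auto simp: nsets_def)
    then obtain T0 where T0: "T0 \<subseteq> \<Union>S0" "T = f ` T0"
      by (rule subset_imageE)
    have T0X: "T0 \<subseteq> X" using T0 S0 BX by auto
    have cT: "card (f ` T0 \<inter> f ` B) = card (T0 \<inter> B)" if "B \<in> \<B>" for B
    proof -
      have "f ` T0 \<inter> f ` B = f ` (T0 \<inter> B)"
        using inj_on_image_Int[OF f T0X, of B] BX that by auto
      then show ?thesis
        using card_image[OF inj_on_subset[OF f, of "T0 \<inter> B"]] T0X by auto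
    qed
    have "card T0 = w"
      using ST T0 card_image[OF inj_on_subset[OF f T0X]] by (auto simp: nsets_def)
    moreover have "finite T0" using T0X X(1) by (rule finite_subset)
    ultimately have "T0 \<in> [\<Union>S0]\<^bsup>w\<^esup>" using T0 by (auto simp: nsets_def)
    with TS S0 ST cS
    have *: "\<not> (\<exists>B \<in> \<B> - S0. \<forall>B' \<in> S0. card (T0 \<inter> B) \<ge> card (T0 \<inter> B'))"
      unfolding traceability_scheme_def by simp
    show "\<not> (\<exists>B \<in> (`) f ` \<B> - S. \<forall>B' \<in> S. card (T \<inter> B) \<ge> card (T \<inter> B'))"
    proof
      assume "\<exists>B \<in> (`) f ` \<B> - S. \<forall>B' \<in> S. card (T \<inter> B) \<ge> card (T \<inter> B')"
      then obtain B where B: "B \<in> \<B> - S0"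
        "\<forall>B' \<in> S0. card (f ` T0 \<inter> f ` B) \<ge> card (f ` T0 \<inter> f ` B')"
        unfolding S0(2) T0(2) by auto
      have "\<forall>B' \<in> S0. card (T0 \<inter> B) \<ge> card (T0 \<inter> B')"
      proof
        fix B' assume B': "B' \<in> S0"
        then have "card (f ` T0 \<inter> f ` B) \<ge> card (f ` T0 \<inter> f ` B')" using B(2) by blast
        moreover have "B \<in> \<B>" "B' \<in> \<B>" using B(1) B' S0(1) by auto
        ultimately show "card (T0 \<inter> B) \<ge> card (T0 \<inter> B')" by (simp only: cT)
      qed
      with * B(1) show False by blast
    qed
  qed
qed

lemma traceability_scheme_card_le:
  fixes X :: "'a set"
  assumes TS: "traceability_scheme t w v X \<B>"
  shows "card \<B> \<le> max_TS_size t w v"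
proof -
  have "finite X" using TS by (simp add: traceability_scheme_def)
  then obtain f :: "'a \<Rightarrow> nat" where "inj_on f X"
    by (metis finite_imp_inj_to_nat_seg)
  note image = traceability_scheme_image[OF TS this]
  have "card \<B> \<in> {card \<C> | \<C>. \<exists>Y :: nat set. traceability_scheme t w v Y \<C>}"
    by (intro CollectI exI conjI) (rule image(2)[symmetric], rule image(1))
  then show ?thesis
    unfolding max_TS_size_def by (rule Max_ge[OF max_TS_size_set(1)])
qed

end

theory Submission
  imports Defs "HOL-Algebra.Algebraic_Closure" "HOL-Number_Theory.Residues"
begin

text \<open>Put \<open>q = t\<^sup>2\<close> and \<open>N = v - d\<close>.

  Upper bound.  A scheme is \<open>q\<close>-cover-free: if \<open>B\<close> is covered by at most \<open>q\<close> other blocks, then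
  averaging over \<open>t\<close> of these gives \<open>t\<close> blocks whose union contains so much of \<open>B\<close> that this part
  of \<open>B\<close>, completed by points lying in just one of them, is an untraceable \<open>w\<close>-set.  Call a pair in
  \<open>B\<close> own if no other block contains it.  If every point of \<open>B\<close> lies in another block, then \<open>B\<close>
  cannot have \<open>d + 1\<close> disjoint pairs that are not own, since these and the remaining \<open>q - d - 1\<close>
  points would be covered by \<open>q\<close> blocks.  By the Erdos-Gallai theorem \<open>B\<close> has at least
  \<open>q (q + 1) / 2\<close> own pairs, with equality only if the other pairs are those meeting some
  \<open>d\<close>-subset \<open>D\<close> of \<open>B\<close>.  Hence \<open>q (q + 1) / 2 * |\<B>|\<close> and the number \<open>e\<close> of pairs own for no
  block add up to at most \<open>v (v - 1) / 2\<close>.  If \<open>e\<close> is less than about \<open>d v\<close>, then few blocks are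
  not extremal, the sets \<open>D\<close> of the blocks through a typical point are the same, and so one set
  \<open>D\<close> is common to all of them, which brings \<open>e\<close> back to \<open>d v\<close>.

  Construction.  Add \<open>d\<close> common points to all the lines of the projective space of dimension \<open>n\<close>
  over the field of order \<open>q\<close>, whose points are the cosets of the multiplicative group of that
  field in the one of the field of order \<open>q\<close> to the power \<open>n + 1\<close>.\<close>

section \<open>Finite projective spaces\<close>

lemma (in cring) binomial_theorem:
  fixes n :: nat
  assumes x: "x \<in> carrier R" and y: "y \<in> carrier R"
  shows "(x \<oplus> y) [^] n = (\<Oplus>k\<in>{..n}. add_pow R (n choose k) (x [^] k \<otimes> y [^] (n - k)))"
proof (induction n)
  case 0
  then show ?case by simp
next
  case (Suc n)
  let ?t = "\<lambda>k. x [^] k \<otimes> y [^] (Suc n - k)"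
  have t: "?t k \<in> carrier R" for k using x y by simp
  \<comment> \<open>The products with \<open>x\<close>, shifted by one place; the value at 0 lets
    both sums run over \<open>{..Suc n}\<close>, where Pascal's rule applies term by term.\<close>
  let ?a = "\<lambda>k. if k = 0 then \<zero> else add_pow R (n choose (k - 1)) (?t k)"
  let ?b = "\<lambda>k. add_pow R (n choose k) (?t k)"
  have "(x \<oplus> y) [^] Suc n = (x \<oplus> y) [^] n \<otimes> x \<oplus> (x \<oplus> y) [^] n \<otimes> y"
    using x y by (simp add: r_distr)
  also have "(x \<oplus> y) [^] n \<otimes> x = (\<Oplus>k\<in>{..n}. add_pow R (n choose k) (x [^] k \<otimes> y [^] (n - k)) \<otimes> x)"
    unfolding Suc.IH by (rule finsum_ldistr) (use x y in auto)
  also have "\<dots> = (\<Oplus>k\<in>{..n}. ?a (Suc k))"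
  proof (rule finsum_cong')
    fix k assume "k \<in> {..n}"
    show "add_pow R (n choose k) (x [^] k \<otimes> y [^] (n - k)) \<otimes> x = ?a (Suc k)"
      using x y by (simp add: add_pow_ldistr add_pow_rdistr m_ac)
  qed (use t x y in auto)
  also have "\<dots> = (\<Oplus>k\<in>{..Suc n}. ?a k)"
    using finsum_Suc2[of ?a n] t x y by (auto simp: Pi_def)
  also have "(x \<oplus> y) [^] n \<otimes> y = (\<Oplus>k\<in>{..n}. add_pow R (n choose k) (x [^] k \<otimes> y [^] (n - k)) \<otimes> y)"
    unfolding Suc.IH by (rule finsum_ldistr) (use x y in auto)
  also have "\<dots> = (\<Oplus>k\<in>{..n}. ?b k)"
  proof (rule finsum_cong')
    fix k assume "k \<in> {..n}"
    then show "add_pow R (n choose k) (x [^] k \<otimes> y [^] (n - k)) \<otimes> y = ?b k"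
      using x y by (simp add: add_pow_ldistr m_assoc Suc_diff_le)
  qed (use t in auto)
  also have "\<dots> = (\<Oplus>k\<in>{..Suc n}. ?b k)"
    using finsum_Suc[of ?b n] t x y by (simp add: Pi_def binomial_eq_0)
  also have "(\<Oplus>k\<in>{..Suc n}. ?a k) \<oplus> (\<Oplus>k\<in>{..Suc n}. ?b k) = (\<Oplus>k\<in>{..Suc n}. ?a k \<oplus> ?b k)"
    by (rule finsum_addf[symmetric]) (use t in auto)
  also have "\<dots> = (\<Oplus>k\<in>{..Suc n}. add_pow R (Suc n choose k) (?t k))"
  proof (rule finsum_cong')
    fix k
    show "?a k \<oplus> ?b k = add_pow R (Suc n choose k) (?t k)"
      using t[of k] add.nat_pow_mult[OF t, of _ k] by (cases k) auto
  qed (use t in auto)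
  finally show ?case .
qed

text \<open>The prime \<open>p\<close> divides \<open>p choose k\<close> for
  \<open>0 < k < p\<close>, so only the two outer terms of the expansion survive.\<close>

lemma (in cring) frobenius_add:
  fixes p :: nat
  assumes p: "Factorial_Ring.prime p" and char: "add_pow R (p) \<one> = \<zero>"
    and x: "x \<in> carrier R" and y: "y \<in> carrier R"
  shows "(x \<oplus> y) [^] p = x [^] p \<oplus> y [^] p"
proof -
  have p0: "p > 0" using p prime_gt_0_nat by blast
  have z: "add_pow R (p) a = \<zero>" if "a \<in> carrier R" for a
    using add_pow_ldistr[of \<one> a p] that char by simp
  let ?f = "\<lambda>k. add_pow R (p choose k) (x [^] k \<otimes> y [^] (p - k))"
  have mid: "?f k = \<zero>" if "k \<noteq> 0" "k < p" for k
  proof -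
    have "p dvd p choose k"
      by (rule dvd_choose_prime) (use that p in auto)
    then obtain c where "p choose k = p * c" by (elim dvdE)
    then show ?thesis
      using add.nat_pow_pow[of "x [^] k \<otimes> y [^] (p - k)" c p] z[of "x [^] k \<otimes> y [^] (p - k)"] x y
      by simp
  qed
  have "(\<Oplus>k\<in>{..p}. ?f k) = (\<Oplus>k\<in>{0, p}. ?f k)"
    by (rule add.finprod_mono_neutral_cong_left[symmetric])
      (use mid x y in \<open>auto simp: Pi_def\<close>)
  also have "\<dots> = x [^] p \<oplus> y [^] p"
    using p0 x y by (subst finsum_insert) (auto simp: a_comm)
  finally show ?thesis using binomial_theorem[OF x y] by simp
qed

lemma (in cring) frobenius_power_add:
  fixes p :: nat
  assumes p: "Factorial_Ring.prime p" and char: "add_pow R (p) \<one> = \<zero>"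
    and x: "x \<in> carrier R" and y: "y \<in> carrier R"
  shows "(x \<oplus> y) [^] (p ^ k) = x [^] (p ^ k) \<oplus> y [^] (p ^ k)"
proof (induction k)
  case (Suc k)
  have "(x \<oplus> y) [^] (p ^ Suc k) = ((x \<oplus> y) [^] (p ^ k)) [^] p"
    using x y by (simp add: nat_pow_pow mult.commute del: nat_pow_closed)
  also have "\<dots> = (x [^] (p ^ k)) [^] p \<oplus> (y [^] (p ^ k)) [^] p"
    unfolding Suc.IH by (rule frobenius_add[OF p char]) (use x y in auto)
  finally show ?case using x y by (simp add: nat_pow_pow mult.commute del: nat_pow_closed)
qed (use x y in simp)

text \<open>Write Q for \<open>p ^ k\<close>. A root \<open>a\<close> satisfies a^Q = a, so the
  substitution Y = X - a turns X^Q - X into Y^Q - Y. If Y^2 divided this, then, as it divides Y^Q,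
  it would divide Y.\<close>

lemma (in field) alg_mult_frobenius_le_one:
  fixes p :: nat
  assumes p: "Factorial_Ring.prime p" and char: "add_pow R p \<one> = \<zero>"
    and k: "k > 0" and a: "a \<in> carrier R"
  shows "alg_mult (X [^]\<^bsub>poly_ring R\<^esub> (p ^ k) \<ominus>\<^bsub>poly_ring R\<^esub> X) a \<le> 1"
proof (rule ccontr)
  interpret UP: domain "poly_ring R"
    by (rule univ_poly_is_domain[OF carrier_is_subring])
  let ?U = "poly_ring R" and ?Q = "p ^ k"
  let ?P = "X [^]\<^bsub>?U\<^esub> ?Q \<ominus>\<^bsub>?U\<^esub> X"
  assume "\<not> alg_mult ?P a \<le> 1"
  then have am: "2 \<le> alg_mult ?P a" by simp
  have Q2: "?Q \<ge> 2"
    using p k by (metis One_nat_def Suc_leI less_or_eq_imp_le numeral_2_eq_2 one_less_power prime_gt_1_nat)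
  have X: "X \<in> carrier ?U" by (rule var_closed[OF carrier_is_subring])
  have P: "?P \<in> carrier ?U" using X by simp
  have root: "is_root ?P a"
    using alg_mult_gt_zero_iff_is_root[OF P, of a] am by simp
  interpret ev: ring_hom_cring ?U R "\<lambda>f. eval f a"
    by (rule eval_cring_hom[OF carrier_is_subring a])
  have aQ: "a [^] ?Q = a"
  proof -
    have "eval ?P a = a [^] ?Q \<ominus> a"
      using X a eval_var[OF a] by (simp add: a_minus_def)
    then have "a [^] ?Q \<ominus> a = \<zero>" using root unfolding is_root_def by simp
    then show ?thesis using a by simp
  qed
  let ?C = "poly_of_const a"
  interpret C: ring_hom_ring R ?U poly_of_const
    using canonical_embedding_ring_hom[OF carrier_is_subring] by simp
  have C: "?C \<in> carrier ?U" using a by simp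
  have CQ: "?C [^]\<^bsub>?U\<^esub> ?Q = ?C"
    using C.hom_nat_pow[OF a, of ?Q] aQ by simp
  have charU: "add_pow ?U p \<one>\<^bsub>?U\<^esub> = \<zero>\<^bsub>?U\<^esub>"
  proof -
    have "add_pow ?U n \<one>\<^bsub>?U\<^esub> = poly_of_const (add_pow R n \<one>)" for n :: nat
      by (induction n) (simp_all)
    then show ?thesis using char by simp
  qed
  let ?Y = "[\<one>, \<ominus> a]"
  have Y: "?Y \<in> carrier ?U"
    using a unfolding univ_poly_carrier[symmetric] polynomial_def by auto
  have XY: "X = ?Y \<oplus>\<^bsub>?U\<^esub> ?C"
    using a unfolding univ_poly_add poly_of_const_def var_def by (auto simp: l_neg)
  have XQ: "X [^]\<^bsub>?U\<^esub> ?Q = ?Y [^]\<^bsub>?U\<^esub> ?Q \<oplus>\<^bsub>?U\<^esub> ?C"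
    unfolding XY UP.frobenius_power_add[OF p charU Y C] CQ ..
  have PY: "?P = ?Y [^]\<^bsub>?U\<^esub> ?Q \<ominus>\<^bsub>?U\<^esub> ?Y"
  proof -
    have "u \<oplus>\<^bsub>?U\<^esub> c \<ominus>\<^bsub>?U\<^esub> (y \<oplus>\<^bsub>?U\<^esub> c) = u \<ominus>\<^bsub>?U\<^esub> y"
      if "u \<in> carrier ?U" "c \<in> carrier ?U" "y \<in> carrier ?U" for u c y
      using that by algebra
    from this[OF UP.nat_pow_closed[OF Y] C Y] show ?thesis
      unfolding XQ using XY by simp
  qed
  let ?Y2 = "?Y [^]\<^bsub>?U\<^esub> (2::nat)"
  have Y2: "?Y2 \<in> carrier ?U" using Y by blast
  have "?Y2 pdivides ?P"
    using le_alg_mult_imp_pdivides[OF a P am] .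
  then obtain r where r: "r \<in> carrier ?U" "?P = ?Y2 \<otimes>\<^bsub>?U\<^esub> r"
    unfolding pdivides_def by (auto simp: factor_def)
  have "?Y2 pdivides ?Y [^]\<^bsub>?U\<^esub> ?Q"
    by (rule polynomial_pow_division[OF Y Q2])
  then obtain s where s: "s \<in> carrier ?U" "?Y [^]\<^bsub>?U\<^esub> ?Q = ?Y2 \<otimes>\<^bsub>?U\<^esub> s"
    unfolding pdivides_def by (auto simp: factor_def)
  have "?Y = ?Y2 \<otimes>\<^bsub>?U\<^esub> (s \<ominus>\<^bsub>?U\<^esub> r)"
  proof -
    have "y = z \<otimes>\<^bsub>?U\<^esub> (s \<ominus>\<^bsub>?U\<^esub> r)"
      if "y \<in> carrier ?U" "z \<in> carrier ?U" "z \<otimes>\<^bsub>?U\<^esub> s \<ominus>\<^bsub>?U\<^esub> y = z \<otimes>\<^bsub>?U\<^esub> r" for y z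
    proof -
      have "z \<otimes>\<^bsub>?U\<^esub> (s \<ominus>\<^bsub>?U\<^esub> r) = z \<otimes>\<^bsub>?U\<^esub> s \<ominus>\<^bsub>?U\<^esub> z \<otimes>\<^bsub>?U\<^esub> r"
        using that(1,2) r(1) s(1) by algebra
      also have "\<dots> = z \<otimes>\<^bsub>?U\<^esub> s \<ominus>\<^bsub>?U\<^esub> (z \<otimes>\<^bsub>?U\<^esub> s \<ominus>\<^bsub>?U\<^esub> y)"
        using that(3) by simp
      also have "\<dots> = y"
        using that(1,2) r(1) s(1) by algebra
      finally show ?thesis by simp
    qed
    from this[OF Y Y2] show ?thesis using r(2) s(2) unfolding PY by simp
  qed
  then have "?Y2 pdivides ?Y"
    unfolding pdivides_def using r(1) s(1) by (metis UP.minus_closed dividesI)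
  then have "degree ?Y2 \<le> degree ?Y"
    using pdivides_imp_degree_le[OF carrier_is_subring Y2 Y] by simp
  then show False
    unfolding polynomial_pow_degree[OF Y] by simp
qed

section \<open>Finite fields inside an algebraic closure\<close>

text \<open>In an algebraic closure of the prime field, X^Q - X with Q = p^k splits and its roots
  are simple, so there are exactly Q of them. One field thus contains all the finite fields of
  characteristic p that are used. The element type is the one that the construction of the closure
  produces.\<close>

lemma ex_field_of_char:
  fixes p :: nat
  assumes p: "Factorial_Ring.prime p"
  obtains L :: "((int list \<times> nat) multiset \<Rightarrow> int) ring"
  where "field L" "add_pow L p \<one>\<^bsub>L\<^esub> = \<zero>\<^bsub>L\<^esub>"
    "\<And>k. k > 0 \<Longrightarrow> card {x \<in> carrier L. x [^]\<^bsub>L\<^esub> (p ^ k) = x} = p ^ k"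
proof -
  interpret R: residues_prime p "residue_ring (int p)" by unfold_locales (rule p)
  obtain L :: "((int list \<times> nat) multiset \<Rightarrow> int) ring"
    where L: "algebraic_closure L (R.indexed_const ` carrier (residue_ring (int p)))"
      and h: "R.indexed_const \<in> ring_hom (residue_ring (int p)) L"
    by (rule R.exists_closure)
  let ?K = "R.indexed_const ` carrier (residue_ring (int p))"
  interpret L: algebraic_closure L ?K by (rule L)
  interpret h: ring_hom_ring "residue_ring (int p)" L R.indexed_const
    by (rule ring_hom_ringI2[OF R.ring_axioms L.ring_axioms h])
  have "add_pow L n \<one>\<^bsub>L\<^esub> = R.indexed_const (int n mod int p)" for n :: nat
  proof (induction n)
    case 0
    then show ?case using h.hom_zero by (simp add: R.zero_cong)
  next
    case (Suc n)
    have "add_pow L (Suc n) \<one>\<^bsub>L\<^esub> = R.indexed_const (int n mod int p) \<oplus>\<^bsub>L\<^esub> R.indexed_const (1 mod int p)"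
      using Suc h.hom_one by (simp add: R.one_cong)
    also have "\<dots> = R.indexed_const (int (Suc n) mod int p)"
      by (subst h.hom_add[symmetric]) (auto simp: R.add_cong add.commute)
    finally show ?case .
  qed
  then have char: "add_pow L p \<one>\<^bsub>L\<^esub> = \<zero>\<^bsub>L\<^esub>"
    using h.hom_zero by (simp add: R.zero_cong)
  have K: "subring ?K L" by (rule L.subring_axioms)
  have count: "card {x \<in> carrier L. x [^]\<^bsub>L\<^esub> (p ^ k) = x} = p ^ k" if k: "k > 0" for k
  proof -
    let ?Q = "p ^ k"
    let ?U = "poly_ring L"
    interpret UP: domain ?U
      by (rule L.univ_poly_is_domain[OF L.carrier_is_subring])
    interpret UK: domain "?K[X]\<^bsub>L\<^esub>"
      by (rule L.univ_poly_is_domain[OF K])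
    let ?P = "X\<^bsub>L\<^esub> [^]\<^bsub>?U\<^esub> ?Q \<ominus>\<^bsub>?U\<^esub> X\<^bsub>L\<^esub>"
    have Q1: "?Q > 1" using p k by (metis one_less_power prime_gt_1_nat)
    have X: "X\<^bsub>L\<^esub> \<in> carrier ?U" by (rule L.var_closed[OF L.carrier_is_subring])
    have XK: "X\<^bsub>L\<^esub> \<in> carrier (?K[X]\<^bsub>L\<^esub>)" by (rule L.var_closed[OF K])
    have P: "?P \<in> carrier ?U" using X by simp
    \<comment> \<open>The closure splits the polynomials over \<open>?K\<close>, so this one is
      recognised as having its coefficients there.\<close>
    have PK: "?P = X\<^bsub>L\<^esub> [^]\<^bsub>?K[X]\<^bsub>L\<^esub>\<^esub> ?Q \<ominus>\<^bsub>?K[X]\<^bsub>L\<^esub>\<^esub> X\<^bsub>L\<^esub>"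
      using L.unitary_monom_eq_var_pow[OF K, of ?Q]
        L.unitary_monom_eq_var_pow[OF L.carrier_is_subring, of ?Q]
        L.univ_poly_a_minus_consistent[OF K XK] by simp
    have PK': "?P \<in> carrier (?K[X]\<^bsub>L\<^esub>)"
      unfolding PK using XK by simp
    have deg: "degree ?P = ?Q"
    proof -
      have m: "X\<^bsub>L\<^esub> [^]\<^bsub>?U\<^esub> ?Q = L.monom \<one>\<^bsub>L\<^esub> ?Q"
        by (rule L.unitary_monom_eq_var_pow[OF L.carrier_is_subring, symmetric])
      have i: "\<ominus>\<^bsub>?U\<^esub> X\<^bsub>L\<^esub> = map (\<lambda>a. \<ominus>\<^bsub>L\<^esub> a) X\<^bsub>L\<^esub>"
        by (rule L.univ_poly_a_inv_def'[OF L.carrier_is_subring X])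
      have d1: "degree (L.monom \<one>\<^bsub>L\<^esub> ?Q) = ?Q" by (simp add: L.monom_def)
      have d2: "degree (\<ominus>\<^bsub>?U\<^esub> X\<^bsub>L\<^esub>) = 1" unfolding i by (simp add: var_def)
      have "degree (ring.poly_add L (L.monom \<one>\<^bsub>L\<^esub> ?Q) (\<ominus>\<^bsub>?U\<^esub> X\<^bsub>L\<^esub>)) = max (degree (L.monom \<one>\<^bsub>L\<^esub> ?Q)) (degree (\<ominus>\<^bsub>?U\<^esub> X\<^bsub>L\<^esub>))"
      proof (rule L.poly_add_degree_eq[OF L.carrier_is_subring])
        show "polynomial\<^bsub>L\<^esub> (carrier L) (L.monom \<one>\<^bsub>L\<^esub> ?Q)"
          unfolding univ_poly_carrier m[symmetric] using X by simp
        show "polynomial\<^bsub>L\<^esub> (carrier L) (\<ominus>\<^bsub>?U\<^esub> X\<^bsub>L\<^esub>)"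
          unfolding univ_poly_carrier using X by simp
      qed (use d1 d2 Q1 in linarith)
      then show ?thesis
        unfolding a_minus_def univ_poly_add m[symmetric] using d1 d2 Q1 m by simp
    qed
    have Pne: "?P \<noteq> []"
    proof
      assume "?P = []"
      then have "degree ?P = 0" by simp
      with deg Q1 show False by linarith
    qed
    have "size (L.roots ?P) = ?Q"
      using L.roots_over_subfield[OF PK'] deg unfolding L.splitted_def by simp
    moreover have "size (L.roots ?P) = card (set_mset (L.roots ?P))"
    proof -
      have "count (L.roots ?P) a = 1" if "a \<in> set_mset (L.roots ?P)" for a
      proof -
        have "a \<in> carrier L"
          using that L.roots_mem_iff_is_root[OF P] unfolding L.is_root_def by simp
        then have "count (L.roots ?P) a \<le> 1"
          using L.alg_mult_frobenius_le_one[OF p char k]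
          by (simp add: L.alg_mult_eq_count_roots[OF P, symmetric])
        with that show ?thesis
          by (metis One_nat_def Suc_leI count_greater_zero_iff le_antisym)
      qed
      then show ?thesis by (simp add: size_multiset_overloaded_eq)
    qed
    moreover have "set_mset (L.roots ?P) = {x \<in> carrier L. x [^]\<^bsub>L\<^esub> ?Q = x}"
    proof -
      have "L.eval ?P a = \<zero>\<^bsub>L\<^esub> \<longleftrightarrow> a [^]\<^bsub>L\<^esub> ?Q = a" if a: "a \<in> carrier L" for a
      proof -
        interpret ev: ring_hom_cring ?U L "\<lambda>f. L.eval f a"
          by (rule L.eval_cring_hom[OF L.carrier_is_subring a])
        have "L.eval ?P a = a [^]\<^bsub>L\<^esub> ?Q \<ominus>\<^bsub>L\<^esub> a"
          using X a L.eval_var[OF a] by (simp add: a_minus_def)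
        then show ?thesis using a by simp
      qed
      then show ?thesis
        using L.roots_mem_iff_is_root[OF P] Pne unfolding L.is_root_def by auto
    qed
    ultimately show ?thesis by simp
  qed
  show thesis by (rule that[OF L.field_axioms char count])
qed

section \<open>Points and lines of a finite projective space\<close>

text \<open>This is a Steiner system S(2, k, card P), the only property of projective spaces that
  the construction of schemes uses.\<close>

definition linear_space :: "nat \<Rightarrow> 'a set \<Rightarrow> 'a set set \<Rightarrow> bool" where
  "linear_space k P \<L> \<longleftrightarrow> finite P \<and> \<L> \<subseteq> [P]\<^bsup>k\<^esup> \<and>
     (\<forall>x\<in>P. \<forall>y\<in>P. x \<noteq> y \<longrightarrow> (\<exists>!l. l \<in> \<L> \<and> x \<in> l \<and> y \<in> l))"

lemma (in field) subfield_frobenius_fixed: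
  fixes p k :: nat
  assumes p: "Factorial_Ring.prime p" and char: "add_pow R p \<one> = \<zero>"
  shows "subfield {x \<in> carrier R. x [^] (p ^ k) = x} R"
proof (rule subfieldI', rule subringI)
  let ?K = "{x \<in> carrier R. x [^] (p ^ k) = x}"
  have p0: "p ^ k > 0" using p prime_gt_0_nat by simp
  show "h \<oplus> h' \<in> ?K" if "h \<in> ?K" "h' \<in> ?K" for h h'
    using that frobenius_power_add[OF p char] by simp
  show "\<ominus> h \<in> ?K" if "h \<in> ?K" for h
  proof -
    have h: "h \<in> carrier R" "h [^] (p ^ k) = h" using that by auto
    \<comment> \<open>Raising \<open>h \<oplus> \<ominus> h\<close> to the power treats odd and even
      characteristic alike.\<close>
    have "h [^] (p ^ k) \<oplus> (\<ominus> h) [^] (p ^ k) = (h \<oplus> \<ominus> h) [^] (p ^ k)"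
      by (rule frobenius_power_add[OF p char, symmetric]) (use h in auto)
    also have "\<dots> = \<zero>" using h p0 by (simp add: r_neg nat_pow_zero)
    finally have "h \<oplus> (\<ominus> h) [^] (p ^ k) = \<zero>" using h by simp
    then have "(\<ominus> h) [^] (p ^ k) = \<ominus> h"
      using h by (metis a_inv_closed add.inv_equality a_comm nat_pow_closed)
    then show ?thesis using h by simp
  qed
  show "h \<otimes> h' \<in> ?K" if "h \<in> ?K" "h' \<in> ?K" for h h'
    using that by (simp add: nat_pow_distrib)
  show "inv h \<in> ?K" if "h \<in> ?K - {\<zero>}" for h
  proof -
    have h: "h \<in> carrier R" "h [^] (p ^ k) = h" "h \<in> Units R"
      using that field_Units by auto
    have "inv h [^] (p ^ k) = inv (h [^] (p ^ k))"
      using h(3) by (metis Units_closed Units_inv_closed Units_l_inv Units_pow_closed Units_r_inv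
          comm_inv_char inv_char m_comm nat_pow_closed nat_pow_distrib nat_pow_one)
    then show ?thesis using h by simp
  qed
qed auto

text \<open>\<open>K\<close> serves as a finite vector space over \<open>F\<close>. For nonzero
  \<open>a\<close>, \<open>b\<close> in different classes, \<open>cls a\<close> is a projective
  point and \<open>lspan a b\<close> a plane of vectors, that is, a projective line.\<close>

locale field_extension_finite = field R for R (structure) +
  fixes F K :: "'a set" and q :: nat
  assumes F: "subfield F R" and K: "subfield K R" and FK: "F \<subseteq> K"
    and finK: "finite K" and cardF: "card F = q"
begin

definition cls :: "'a \<Rightarrow> 'a set" where
  "cls a = (\<lambda>c. c \<otimes> a) ` (F - {\<zero>})"

definition lspan :: "'a \<Rightarrow> 'a \<Rightarrow> 'a set" where
  "lspan a b = (\<lambda>(x, y). x \<otimes> a \<oplus> y \<otimes> b) ` (F \<times> F)"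

lemmas F_closed = subringE[OF subfieldE(1)[OF F]]
lemmas K_closed = subringE[OF subfieldE(1)[OF K]]

lemma carr: "x \<in> K \<Longrightarrow> x \<in> carrier R" "x \<in> F \<Longrightarrow> x \<in> carrier R"
  using K_closed(1) F_closed(1) by auto

lemma F_inv: "x \<in> F \<Longrightarrow> x \<noteq> \<zero> \<Longrightarrow> inv x \<in> F \<and> inv x \<noteq> \<zero> \<and> inv x \<otimes> x = \<one>"
  using subfield_m_inv[OF F, of x] by auto

lemma q_gt_1: "q > 1"
proof -
  have "card {\<zero>, \<one>} \<le> card F"
    by (rule card_mono) (use finK FK F_closed(2,3) in \<open>auto intro: finite_subset\<close>)
  then show ?thesis using cardF by simp
qed

lemma card_F0: "card (F - {\<zero>}) = q - 1"
  using cardF F_closed(2) by simp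

lemma cls_self: "a \<in> carrier R \<Longrightarrow> a \<in> cls a"
  unfolding cls_def using F_closed(3) by (intro image_eqI[of _ _ \<one>]) auto

lemma cls_card:
  assumes "a \<in> carrier R" "a \<noteq> \<zero>"
  shows "card (cls a) = q - 1"
proof -
  have "inj_on (\<lambda>c. c \<otimes> a) (F - {\<zero>})"
    using assms carr(2) m_rcancel by (auto intro!: inj_onI)
  then show ?thesis unfolding cls_def by (simp add: card_image card_F0)
qed

lemma cls_eq:
  assumes a: "a \<in> carrier R" and b: "b \<in> cls a"
  shows "cls b = cls a"
proof -
  obtain c where c: "c \<in> F" "c \<noteq> \<zero>" "b = c \<otimes> a" using b unfolding cls_def by auto
  have sub: "cls (d \<otimes> x) \<subseteq> cls x" if "d \<in> F" "d \<noteq> \<zero>" "x \<in> carrier R" for d x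
  proof
    fix y assume "y \<in> cls (d \<otimes> x)"
    then obtain e where "e \<in> F" "e \<noteq> \<zero>" "y = e \<otimes> (d \<otimes> x)" unfolding cls_def by auto
    then have "y = (e \<otimes> d) \<otimes> x" "e \<otimes> d \<in> F" "e \<otimes> d \<noteq> \<zero>"
      using that F_closed(6) carr(2) by (auto simp: m_assoc integral_iff)
    then show "y \<in> cls x" unfolding cls_def by auto
  qed
  have "a = inv c \<otimes> b"
    using c a F_inv[of c] carr(2) by (simp add: m_assoc[symmetric])
  then have "cls a \<subseteq> cls b"
    using sub[of "inv c" b] F_inv[of c] c a carr(2) by simp
  then show ?thesis using sub[OF c(1,2) a] c(3) by blast
qed

lemma cls_disjoint:
  assumes "a \<in> carrier R" "b \<in> carrier R" "cls a \<noteq> cls b"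
  shows "cls a \<inter> cls b = {}"
  using cls_eq assms by (metis disjoint_iff)

text \<open>The classes partition \<open>V - {\<zero>}\<close> into sets of \<open>q - 1\<close>
  elements. \<open>V\<close> will be a span \<open>lspan a b\<close> or all of
  \<open>K\<close>.\<close>

lemma cls_count:
  assumes V: "V \<subseteq> K" "\<And>c x. c \<in> F \<Longrightarrow> x \<in> V \<Longrightarrow> c \<otimes> x \<in> V"
  shows "card (cls ` (V - {\<zero>})) * (q - 1) = card (V - {\<zero>})"
proof -
  have V0: "V - {\<zero>} \<subseteq> carrier R" using V(1) carr by auto
  have "\<Union> (cls ` (V - {\<zero>})) = V - {\<zero>}"
  proof
    show "\<Union> (cls ` (V - {\<zero>})) \<subseteq> V - {\<zero>}"
      using V V0 carr(2) by (auto simp: cls_def integral_iff subset_iff)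
    show "V - {\<zero>} \<subseteq> \<Union> (cls ` (V - {\<zero>}))"
      using cls_self V0 by auto
  qed
  moreover have "card (cls ` (V - {\<zero>})) * (q - 1) = card (\<Union> (cls ` (V - {\<zero>})))"
    unfolding mult.commute[of _ "q - 1"]
  proof (rule card_partition)
    have fin: "finite (V - {\<zero>})" using V(1) finK by (auto intro: finite_subset)
    then show "finite (cls ` (V - {\<zero>}))" by simp
    show "finite (\<Union> (cls ` (V - {\<zero>})))" using fin calculation by simp
    show "card c = q - 1" if "c \<in> cls ` (V - {\<zero>})" for c
      using that V0 cls_card by auto
    show "c \<inter> c' = {}" if "c \<in> cls ` (V - {\<zero>})" "c' \<in> cls ` (V - {\<zero>})" "c \<noteq> c'" for c c'
      using that V0 cls_disjoint by auto
  qed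
  ultimately show ?thesis by simp
qed

lemma lspan_scale:
  assumes "a \<in> K" "b \<in> K" "c \<in> F" "x \<in> lspan a b"
  shows "c \<otimes> x \<in> lspan a b"
proof -
  obtain u v where "u \<in> F" "v \<in> F" "x = u \<otimes> a \<oplus> v \<otimes> b"
    using assms(4) unfolding lspan_def by auto
  moreover from this have "c \<otimes> x = (c \<otimes> u) \<otimes> a \<oplus> (c \<otimes> v) \<otimes> b"
    using assms carr by (simp add: r_distr m_assoc)
  ultimately show ?thesis
    using assms(3) F_closed(6) unfolding lspan_def by auto
qed

lemma lspan_add:
  assumes "a \<in> K" "b \<in> K" "x \<in> lspan a b" "y \<in> lspan a b"
  shows "x \<oplus> y \<in> lspan a b"
proof -
  obtain u v where 1: "u \<in> F" "v \<in> F" "x = u \<otimes> a \<oplus> v \<otimes> b"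
    using assms(3) unfolding lspan_def by auto
  obtain u' v' where 2: "u' \<in> F" "v' \<in> F" "y = u' \<otimes> a \<oplus> v' \<otimes> b"
    using assms(4) unfolding lspan_def by auto
  have "a \<in> carrier R" "b \<in> carrier R" "u \<in> carrier R" "v \<in> carrier R" "u' \<in> carrier R" "v' \<in> carrier R"
    using assms 1 2 carr by auto
  then have "x \<oplus> y = (u \<oplus> u') \<otimes> a \<oplus> (v \<oplus> v') \<otimes> b"
    unfolding 1 2 by algebra
  then show ?thesis
    using 1 2 F_closed(7) unfolding lspan_def by auto
qed

lemma lspan_subset: "a \<in> K \<Longrightarrow> b \<in> K \<Longrightarrow> lspan a b \<subseteq> K"
  using subsetD[OF FK] K_closed(6,7) by (auto simp: lspan_def)

lemma lspan_gens:
  assumes "a \<in> K" "b \<in> K"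
  shows "a \<in> lspan a b" "b \<in> lspan a b" "\<zero> \<in> lspan a b"
  unfolding lspan_def using assms carr F_closed(2,3)
  by (auto intro: image_eqI[of _ _ "(\<one>, \<zero>)"] image_eqI[of _ _ "(\<zero>, \<one>)"] image_eqI[of _ _ "(\<zero>, \<zero>)"])

text \<open>Two coefficient pairs with the same value give a linear relation between
  \<open>a\<close> and \<open>b\<close>; a nontrivial one would put \<open>b\<close> into the class
  of \<open>a\<close>.\<close>

lemma lspan_card:
  assumes a: "a \<in> K" "a \<noteq> \<zero>" and b: "b \<in> K" and ab: "b \<notin> cls a" "b \<noteq> \<zero>"
  shows "card (lspan a b) = q ^ 2"
proof -
  have ca: "a \<in> carrier R" "b \<in> carrier R" using a b carr by auto
  have "inj_on (\<lambda>(x, y). x \<otimes> a \<oplus> y \<otimes> b) (F \<times> F)"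
  proof (rule inj_onI, clarsimp)
    fix x y x' y' assume xy: "x \<in> F" "y \<in> F" "x' \<in> F" "y' \<in> F"
      and eq: "x \<otimes> a \<oplus> y \<otimes> b = x' \<otimes> a \<oplus> y' \<otimes> b"
    have cx: "x \<in> carrier R" "y \<in> carrier R" "x' \<in> carrier R" "y' \<in> carrier R"
      using xy carr by auto
    have eq': "(x \<ominus> x') \<otimes> a = (y' \<ominus> y) \<otimes> b"
    proof -
      have "(x \<ominus> x') \<otimes> a = (x \<otimes> a \<oplus> y \<otimes> b) \<ominus> (x' \<otimes> a \<oplus> y \<otimes> b)"
        using cx ca by algebra
      also have "\<dots> = (y' \<ominus> y) \<otimes> b" unfolding eq using cx ca by algebra
      finally show ?thesis .
    qed
    have m: "u \<ominus> v \<in> F" if "u \<in> F" "v \<in> F" for u v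
      using that F_closed(5,7) by (simp add: a_minus_def)
    have y': "y' = y"
    proof (rule ccontr)
      assume "y' \<noteq> y"
      then have ne: "y' \<ominus> y \<noteq> \<zero>" using cx by simp
      let ?c = "y' \<ominus> y"
      have i: "inv ?c \<in> F" "inv ?c \<noteq> \<zero>" "inv ?c \<otimes> ?c = \<one>"
        using F_inv[OF m[OF xy(4,2)] ne] by auto
      have "b = inv ?c \<otimes> (?c \<otimes> b)"
        using i ca cx carr(2) by (simp add: m_assoc[symmetric])
      then have b': "b = (inv ?c \<otimes> (x \<ominus> x')) \<otimes> a"
        using i ca cx carr(2) unfolding eq'[symmetric] by (simp add: m_assoc)
      moreover have "inv ?c \<otimes> (x \<ominus> x') \<in> F"
        using i(1) m[OF xy(1,3)] F_closed(6) by blast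
      moreover have "inv ?c \<otimes> (x \<ominus> x') \<noteq> \<zero>" using b' ab(2) ca by auto
      ultimately show False using ab(1) unfolding cls_def by blast
    qed
    then have "(x \<ominus> x') \<otimes> a = (y \<ominus> y) \<otimes> b" using eq' by simp
    moreover have "y \<ominus> y = \<zero>" using cx by (simp add: a_minus_def r_neg)
    ultimately have "(x \<ominus> x') \<otimes> a = \<zero>" using eq' ca by simp
    then have "x = x'" using a(2) cx ca by (simp add: integral_iff)
    with y' show "x = x' \<and> y = y'" by simp
  qed
  then show ?thesis
    unfolding lspan_def by (simp add: card_image card_cartesian_product cardF power2_eq_square)
qed

text \<open>Closure under the operations gives one inclusion; equality follows because both spans
  have \<open>q ^ 2\<close> elements, without solving for \<open>c\<close> and
  \<open>e\<close>.\<close>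

lemma lspan_eq:
  assumes c: "c \<in> K" "c \<noteq> \<zero>" "e \<in> K" "e \<noteq> \<zero>" "e \<notin> cls c"
    and a: "a \<in> lspan c e" "a \<noteq> \<zero>" "b \<in> lspan c e" "b \<noteq> \<zero>" "b \<notin> cls a"
  shows "lspan a b = lspan c e"
proof (rule card_subset_eq)
  have K': "a \<in> K" "b \<in> K" using lspan_subset c a by auto
  show "finite (lspan c e)" using lspan_subset c finK by (metis finite_subset)
  show "lspan a b \<subseteq> lspan c e"
  proof
    fix z assume "z \<in> lspan a b"
    then obtain x y where "x \<in> F" "y \<in> F" "z = x \<otimes> a \<oplus> y \<otimes> b" unfolding lspan_def by auto
    then show "z \<in> lspan c e" using lspan_add lspan_scale c a by auto
  qed
  show "card (lspan a b) = card (lspan c e)"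
    using lspan_card K' a c by simp
qed

text \<open>By \<open>cls_count\<close> a line has (q^2 - 1) / (q - 1) = q + 1 points. The plane of
  any line through two points contains representatives of both, so by \<open>lspan_eq\<close> it is
  their span.\<close>

lemma linear_space_lines:
  "linear_space (q + 1) (cls ` (K - {\<zero>}))
     {cls ` (lspan a b - {\<zero>}) | a b. a \<in> K - {\<zero>} \<and> b \<in> K - {\<zero>} \<and> b \<notin> cls a}"
    (is "linear_space _ ?P ?L")
  unfolding linear_space_def
proof (intro conjI ballI impI subsetI)
  show "finite ?P" using finK by simp
next
  fix l assume "l \<in> ?L"
  then obtain a b where ab: "a \<in> K" "a \<noteq> \<zero>" "b \<in> K" "b \<noteq> \<zero>" "b \<notin> cls a"
    and l: "l = cls ` (lspan a b - {\<zero>})" by auto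
  have "card l * (q - 1) = card (lspan a b - {\<zero>})"
    unfolding l by (rule cls_count) (use lspan_subset lspan_scale ab in auto)
  also have "\<dots> = q ^ 2 - 1"
    using lspan_card lspan_gens(3) ab by simp
  also have "\<dots> = (q + 1) * (q - 1)"
    by (simp add: power2_eq_square algebra_simps diff_mult_distrib2)
  finally have "card l = q + 1" unfolding mult_cancel2 using q_gt_1 by linarith
  moreover have "l \<subseteq> ?P" unfolding l using lspan_subset ab by auto
  moreover have "finite l" unfolding l using lspan_subset[of a b] ab finK
    by (metis finite_Diff finite_imageI finite_subset)
  ultimately show "l \<in> nsets ?P (q + 1)" by (simp add: nsets_def)
next
  fix x y assume "x \<in> ?P" "y \<in> ?P" and xy: "x \<noteq> y"
  then obtain a b where a: "a \<in> K" "a \<noteq> \<zero>" "x = cls a" and b: "b \<in> K" "b \<noteq> \<zero>" "y = cls b"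
    by auto
  have ba: "b \<notin> cls a" using xy a b cls_eq carr by metis
  show "\<exists>!l. l \<in> ?L \<and> x \<in> l \<and> y \<in> l"
  proof (rule ex1I[of _ "cls ` (lspan a b - {\<zero>})"])
    show "cls ` (lspan a b - {\<zero>}) \<in> ?L \<and> x \<in> cls ` (lspan a b - {\<zero>}) \<and> y \<in> cls ` (lspan a b - {\<zero>})"
      using a b ba lspan_gens by auto
  next
    fix l assume l: "l \<in> ?L \<and> x \<in> l \<and> y \<in> l"
    then obtain c e where ce: "c \<in> K" "c \<noteq> \<zero>" "e \<in> K" "e \<noteq> \<zero>" "e \<notin> cls c"
      and lce: "l = cls ` (lspan c e - {\<zero>})" by auto
    have mem: "z \<in> lspan c e" if z: "z \<in> K" "cls z \<in> l" for z
    proof -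
      obtain u where u: "u \<in> lspan c e" "cls z = cls u" using z(2) lce by auto
      then have "z \<in> cls u" using cls_self carr z(1) by blast
      then show ?thesis using u(1) lspan_scale ce unfolding cls_def by auto
    qed
    have "lspan a b = lspan c e"
      by (rule lspan_eq[OF ce]) (use mem a b ba l in auto)
    then show "l = cls ` (lspan a b - {\<zero>})" using lce by simp
  qed
qed

lemma card_points: "card (cls ` (K - {\<zero>})) * (q - 1) = card K - 1"
  using cls_count[of K] K_closed(2,6) FK by auto

end

text \<open>Inside one closure, take for \<open>F\<close> and \<open>K\<close> the fixed points of x
  -> x^q and of its (n+1)-fold iterate. Then \<open>F\<close> lies in \<open>K\<close>, which has
  q^(n+1) elements, and there are (q^(n+1) - 1) / (q - 1) classes.\<close>

theorem ex_projective_space: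
  fixes q n :: nat
  assumes q: "primepow q"
  obtains P :: "(((int list \<times> nat) multiset \<Rightarrow> int) set) set" and \<L>
  where "linear_space (q + 1) P \<L>" "card P = (\<Sum>i\<le>n. q ^ i)"
proof -
  obtain p e where p: "Factorial_Ring.prime p" and e: "e > 0" and qp: "q = p ^ e"
    using q unfolding primepow_def by auto
  obtain L :: "((int list \<times> nat) multiset \<Rightarrow> int) ring"
    where L: "field L" and char: "add_pow L p \<one>\<^bsub>L\<^esub> = \<zero>\<^bsub>L\<^esub>"
    and count: "\<And>k. k > 0 \<Longrightarrow> card {x \<in> carrier L. x [^]\<^bsub>L\<^esub> (p ^ k) = x} = p ^ k"
    using ex_field_of_char[OF p] by blast
  interpret L: field L by (rule L)
  define Fx where "Fx k = {x \<in> carrier L. x [^]\<^bsub>L\<^esub> (p ^ k) = x}" for k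
  have sub: "Fx e \<subseteq> Fx (e * j)" for j
  proof
    fix x assume x: "x \<in> Fx e"
    then have "x [^]\<^bsub>L\<^esub> (p ^ (e * j)) = x"
      by (induction j) (auto simp: Fx_def power_add L.nat_pow_pow[symmetric])
    then show "x \<in> Fx (e * j)" using x by (simp add: Fx_def)
  qed
  let ?k = "e * (n + 1)"
  have cK: "card (Fx ?k) = q ^ (n + 1)"
    using count[of ?k] e unfolding Fx_def qp by (simp add: power_mult power_add)
  interpret E: field_extension_finite L "Fx e" "Fx ?k" q
  proof (intro field_extension_finite.intro field_extension_finite_axioms.intro L.field_axioms)
    show "subfield (Fx e) L" "subfield (Fx ?k) L"
      unfolding Fx_def by (rule L.subfield_frobenius_fixed[OF p char])+
    show "card (Fx e) = q" using count[OF e] by (simp add: Fx_def qp)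
    have "card (Fx ?k) > 0" using cK p by (simp add: qp prime_gt_0_nat)
    then show "finite (Fx ?k)" by (rule card_ge_0_finite)
    show "Fx e \<subseteq> Fx ?k" by (rule sub)
  qed
  have "card (E.cls ` (Fx ?k - {\<zero>\<^bsub>L\<^esub>})) * (q - 1) = (\<Sum>i\<le>n. q ^ i) * (q - 1)"
  proof -
    have "(\<Sum>i\<le>n. q ^ i) * (q - 1) = q ^ (n + 1) - 1"
    proof -
      have "int ((\<Sum>i\<le>n. q ^ i) * (q - 1)) = int (q ^ (n + 1) - 1)"
        using power_diff_1_eq[of "int q" "Suc n"] E.q_gt_1
        by (simp add: of_nat_diff lessThan_Suc_atMost mult.commute)
      then show ?thesis using of_nat_eq_iff by blast
    qed
    then show ?thesis using E.card_points cK by simp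
  qed
  then have "card (E.cls ` (Fx ?k - {\<zero>\<^bsub>L\<^esub>})) = (\<Sum>i\<le>n. q ^ i)"
    using E.q_gt_1 by simp
  with E.linear_space_lines show thesis by (rule that)
qed

text \<open>The notation of \<^theory>\<open>HOL-Algebra.Polynomials\<close> turns \<open>X\<close> into a keyword,
  and that of \<^theory>\<open>HOL-Algebra.AbelCoset\<close> overloads the disjoint sum.\<close>

no_notation var (\<open>X\<index>\<close>)
no_notation univ_poly (\<open>(\<open>open_block notation=\<open>postfix X\<close>\<close>_ [X]\<index>)\<close> 80)
no_notation set_add (infixl \<open><+>\<index>\<close> 60)

section \<open>Traceability schemes are cover-free\<close>

text \<open>Finiteness of \<open>S\<close> is demanded explicitly because \<open>card\<close> is 0
  on infinite sets.\<close>

definition cover_free :: "nat \<Rightarrow> 'a set set \<Rightarrow> bool" where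
  "cover_free r \<B> \<longleftrightarrow>
     (\<forall>B\<in>\<B>. \<forall>S. S \<subseteq> \<B> - {B} \<and> finite S \<and> card S \<le> r \<longrightarrow> \<not> B \<subseteq> \<Union>S)"

lemma TS_D:
  assumes "traceability_scheme t w v X \<B>"
  shows "finite X" "card X = v" "\<And>B. B \<in> \<B> \<Longrightarrow> B \<subseteq> X \<and> finite B \<and> card B = w"
    "\<And>S T B. S \<subseteq> \<B> \<Longrightarrow> 1 \<le> card S \<Longrightarrow> card S \<le> t \<Longrightarrow> T \<subseteq> \<Union>S \<Longrightarrow> finite T \<Longrightarrow>
       card T = w \<Longrightarrow> B \<in> \<B> - S \<Longrightarrow> \<exists>B'\<in>S. card (T \<inter> B) < card (T \<inter> B')"
proof -
  show "finite X" "card X = v" "\<And>B. B \<in> \<B> \<Longrightarrow> B \<subseteq> X \<and> finite B \<and> card B = w"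
    using assms by (auto simp: traceability_scheme_def nsets_def)
  fix S T B
  assume a: "S \<subseteq> \<B>" "1 \<le> card S" "card S \<le> t" "T \<subseteq> \<Union>S" "finite T" "card T = w" "B \<in> \<B> - S"
  then have "T \<in> [\<Union>S]\<^bsup>w\<^esup>" by (simp add: nsets_def)
  then have "\<not> (\<forall>B'\<in>S. card (T \<inter> B) \<ge> card (T \<inter> B'))"
    using assms a unfolding traceability_scheme_def by blast
  then show "\<exists>B'\<in>S. card (T \<inter> B) < card (T \<inter> B')" by (auto simp: not_le)
qed

text \<open>If the shared points contained a \<open>w\<close>-set \<open>T\<close>, then \<open>T\<close> would be covered by all the blocks
  of \<open>C\<close> but one, whichever one is left out: leave out one that meets \<open>T\<close> most.\<close>

lemma TS_card_shared_less:
  assumes TS: "traceability_scheme t w v X \<B>"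
    and C: "C \<subseteq> \<B>" "2 \<le> card C" "card C \<le> t + 1"
  defines "Y \<equiv> {x. \<exists>B\<in>C. \<exists>B'\<in>C. B \<noteq> B' \<and> x \<in> B \<and> x \<in> B'}"
  shows "finite Y" "card Y < w"
proof -
  note D = TS_D[OF TS]
  have "Y \<subseteq> X" using C(1) D(3) by (auto simp: Y_def)
  then show finY: "finite Y" using D(1) by (rule finite_subset)
  show "card Y < w"
  proof (rule ccontr)
    assume "\<not> card Y < w"
    then obtain T where T: "T \<subseteq> Y" "card T = w" "finite T"
      by (metis not_less obtain_subset_with_card_n)
    have finC: "finite C" using C(2) by (metis card.infinite not_numeral_le_zero)
    let ?A = "(\<lambda>B. card (T \<inter> B)) ` C"
    have "C \<noteq> {}" using C(2) by auto
    then have "Max ?A \<in> ?A" by (intro Max_in) (use finC in auto)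
    then obtain B where B: "B \<in> C" "Max ?A = card (T \<inter> B)" by auto
    have "T \<subseteq> \<Union>(C - {B})"
    proof
      fix x assume "x \<in> T"
      then obtain B1 B2 where "B1 \<in> C" "B2 \<in> C" "B1 \<noteq> B2" "x \<in> B1" "x \<in> B2"
        using T(1) unfolding Y_def by blast
      then show "x \<in> \<Union>(C - {B})" by (cases "B1 = B") auto
    qed
    moreover have "card (C - {B}) = card C - 1" using B(1) by simp
    moreover from this have "1 \<le> card (C - {B})" "card (C - {B}) \<le> t" using C by linarith+
    ultimately obtain B' where "B' \<in> C - {B}" "card (T \<inter> B) < card (T \<inter> B')"
      using D(4)[of "C - {B}" T B] C(1) T B(1) by blast
    moreover from this have "card (T \<inter> B') \<le> Max ?A" by (intro Max_ge) (use finC in auto)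
    ultimately show False using B(2) by simp
  qed
qed

text \<open>Let c be the size of \<open>B \<inter> \<Union>S\<close>. If the inequality failed, this
  set could be completed to a \<open>w\<close>-set by at most c -
  \<open>card (B \<inter> B')\<close> points from each \<open>B'\<close> in \<open>S\<close> that
  lie in no other of the blocks. Then \<open>B\<close> meets the \<open>w\<close>-set in at least c
  points and each \<open>B'\<close> in at most c, so it is untraceable.
  \<open>TS_card_shared_less\<close> guarantees that enough such points exist.\<close>

lemma TS_intersection_bound:
  assumes TS: "traceability_scheme t w v X \<B>"
    and B: "B \<in> \<B>" and S: "S \<subseteq> \<B> - {B}" "1 \<le> card S" "card S \<le> t"
  shows "(card S + 1) * card (B \<inter> \<Union>S) < w + (\<Sum>B'\<in>S. card (B \<inter> B'))"
proof (rule ccontr)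
  assume large: "\<not> ?thesis"
  note D = TS_D[OF TS]
  let ?c = "card (B \<inter> \<Union>S)"
  have finS: "finite S" using S(2) by (metis card.infinite not_one_le_zero)
  have finB: "finite B" "card B = w" using D(3)[OF B] by auto
  let ?C = "insert B S"
  define Y where "Y = {x. \<exists>B'\<in>?C. \<exists>B''\<in>?C. B' \<noteq> B'' \<and> x \<in> B' \<and> x \<in> B''}"
  have BS: "B \<notin> S" using S(1) by auto
  have Y: "finite Y" "card Y < w"
    unfolding Y_def by (rule TS_card_shared_less[OF TS]; use B S BS finS in auto)+
  have BY: "B \<inter> \<Union>S \<subseteq> Y" using BS by (auto simp: Y_def)
  \<comment> \<open>Both \<open>B \<inter> \<Union>S\<close> and \<open>B' \<inter> Y\<close> lie in
    \<open>Y\<close>, and they meet in \<open>B \<inter> B'\<close>; as \<open>Y\<close> has fewer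
    than \<open>w\<close> points, inclusion-exclusion leaves enough of \<open>B'\<close> outside
    \<open>Y\<close>.\<close>
  have "\<exists>R. R \<subseteq> B' - Y \<and> card R = ?c - card (B \<inter> B')" if B': "B' \<in> S" for B'
  proof -
    have fB': "finite B'" "card B' = w" using D(3)[of B'] B' S(1) by auto
    have "card ((B \<inter> \<Union>S) \<union> (B' \<inter> Y)) + card ((B \<inter> \<Union>S) \<inter> (B' \<inter> Y)) = ?c + card (B' \<inter> Y)"
      by (rule card_Un_Int[symmetric]) (use finB fB' in auto)
    moreover have "(B \<inter> \<Union>S) \<inter> (B' \<inter> Y) = B \<inter> B'" using BY B' by auto
    then have "card ((B \<inter> \<Union>S) \<inter> (B' \<inter> Y)) = card (B \<inter> B')" by simp
    moreover have "card ((B \<inter> \<Union>S) \<union> (B' \<inter> Y)) \<le> card Y"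
      by (rule card_mono[OF Y(1)]) (use BY in auto)
    moreover have "card B' = card (B' \<inter> Y) + card (B' - Y)" by (rule card_Int_Diff[OF fB'(1)])
    ultimately have "?c - card (B \<inter> B') \<le> card (B' - Y)" using Y(2) fB'(2) by linarith
    then show ?thesis by (rule obtain_subset_with_card_n) blast
  qed
  note exR = this
  define R where "R B' = (SOME R. R \<subseteq> B' - Y \<and> card R = ?c - card (B \<inter> B'))" for B'
  have R: "R B' \<subseteq> B' - Y" "card (R B') = ?c - card (B \<inter> B')" if "B' \<in> S" for B'
    using someI_ex[OF exR[OF that]] unfolding R_def by blast+
  have finR: "finite (R B')" if "B' \<in> S" for B'
    by (rule finite_subset[OF R(1)[OF that]]) (use D(3)[of B'] that S(1) in auto)
  let ?T1 = "(B \<inter> \<Union>S) \<union> (\<Union>B'\<in>S. R B')"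
  have cT1: "card ?T1 = ?c + (\<Sum>B'\<in>S. ?c - card (B \<inter> B'))"
  proof -
    have "card ?T1 = ?c + card (\<Union>B'\<in>S. R B')"
    proof (rule card_Un_disjoint)
      show "(B \<inter> \<Union>S) \<inter> (\<Union>B'\<in>S. R B') = {}" using BY R(1) by blast
    qed (use finB finS finR in auto)
    also have "card (\<Union>B'\<in>S. R B') = (\<Sum>B'\<in>S. card (R B'))"
    proof (rule card_UN_disjoint[OF finS])
      show "\<forall>B'\<in>S. finite (R B')" using finR by blast
      show "\<forall>B'\<in>S. \<forall>B''\<in>S. B' \<noteq> B'' \<longrightarrow> R B' \<inter> R B'' = {}"
      proof (intro ballI impI)
        fix B' B'' assume b: "B' \<in> S" "B'' \<in> S" "B' \<noteq> B''"
        then have "B' \<inter> B'' \<subseteq> Y" by (auto simp: Y_def)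
        then show "R B' \<inter> R B'' = {}" using R(1)[OF b(1)] R(1)[OF b(2)] by blast
      qed
    qed
    finally show ?thesis using R(2) by simp
  qed
  \<comment> \<open>No subtraction is truncated, so \<open>card ?T1\<close> is
    \<open>(card S + 1) * ?c\<close> minus the sum of the intersections, which is at least
    \<open>w\<close> by the assumed failure.\<close>
  have "(\<Sum>B'\<in>S. ?c - card (B \<inter> B')) + (\<Sum>B'\<in>S. card (B \<inter> B')) = card S * ?c"
  proof -
    have "card (B \<inter> B') \<le> ?c" if "B' \<in> S" for B'
      by (rule card_mono) (use finB that in auto)
    then show ?thesis by (simp add: sum.distrib[symmetric])
  qed
  then have "w \<le> card ?T1" using large cT1 by simp
  moreover have "?c \<le> w" using finB card_mono[of B "B \<inter> \<Union>S"] by auto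
  moreover have "finite ?T1" using finB finS finR by auto
  ultimately obtain T where T: "B \<inter> \<Union>S \<subseteq> T" "T \<subseteq> ?T1" "card T = w"
    using exists_subset_between[of "B \<inter> \<Union>S" w ?T1] by auto
  have finT: "finite T" using T(2) \<open>finite ?T1\<close> by (rule finite_subset)
  have "T \<subseteq> \<Union>S" using T(2) R(1) by blast
  then obtain B' where B': "B' \<in> S" "card (T \<inter> B) < card (T \<inter> B')"
    using D(4)[of S T B] S B BS T(3) finT by blast
  have "?c \<le> card (T \<inter> B)" by (rule card_mono) (use finT T(1) in auto)
  moreover have "card (T \<inter> B') \<le> card ((B \<inter> B') \<union> R B')"
  proof (rule card_mono)
    show "finite ((B \<inter> B') \<union> R B')" using finB finR B' by auto
    have "R B'' \<inter> B' = {}" if "B'' \<in> S" "B'' \<noteq> B'" for B''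
    proof -
      have "B'' \<inter> B' \<subseteq> Y" using that B' by (auto simp: Y_def)
      then show ?thesis using R(1)[OF that(1)] by blast
    qed
    then show "T \<inter> B' \<subseteq> (B \<inter> B') \<union> R B'" using T(2) B' by blast
  qed
  moreover have "card ((B \<inter> B') \<union> R B') \<le> card (B \<inter> B') + (?c - card (B \<inter> B'))"
    using card_Un_le[of "B \<inter> B'" "R B'"] R(2)[OF B'(1)] by simp
  moreover have "card (B \<inter> B') \<le> ?c" by (rule card_mono) (use finB B' in auto)
  ultimately show False using B'(2) by linarith
qed

section \<open>Averaging over the \<open>t\<close>-subsets of a cover\<close>

text \<open>For positive \<open>a\<close> and \<open>t\<close>, the ratio of
  \<open>a choose t\<close> to \<open>a\<close> is that of \<open>a - 1 choose (t - 1)\<close> to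
  \<open>t\<close>, which grows with \<open>a\<close>. The factor \<open>t\<close> on both sides
  includes the case \<open>t = 0\<close>.\<close>

lemma binomial_ratio_mono:
  fixes a b t :: nat
  assumes "a \<le> b"
  shows "b * (a choose t) * t \<le> a * (b choose t) * t"
proof (cases "t = 0 \<or> a = 0")
  case True
  then show ?thesis by (cases "t = 0") (auto simp: binomial_eq_0)
next
  case False
  then have a: "a * (a - 1 choose (t - 1)) = (a choose t) * t" and b: "b * (b - 1 choose (t - 1)) = (b choose t) * t"
    using assms times_binomial_minus1_eq[of t a] times_binomial_minus1_eq[of t b] by (simp_all add: mult.commute)
  have "b * (a choose t) * t = b * (a * (a - 1 choose (t - 1)))" using a by (simp add: mult.assoc)
  also have "\<dots> \<le> b * (a * (b - 1 choose (t - 1)))"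
    using assms by (intro mult_le_mono binomial_right_mono) auto
  also have "\<dots> = a * (b choose t) * t" using b by (simp add: mult.assoc mult.left_commute)
  finally show ?thesis .
qed

text \<open>The contribution of one point lying on \<open>M\<close> of \<open>r\<close> covering
  blocks: \<open>r - M choose t\<close> of the \<open>t\<close>-subsets miss it, and
  \<open>M * (r - 1 choose (t - 1))\<close> counts its incidences with blocks over all the
  \<open>t\<close>-subsets. After multiplication by \<open>r * (r - 1)\<close>, both terms are
  bounded by multiples of \<open>r choose t\<close>.\<close>

lemma binomial_cover_inequality:
  fixes r t M :: nat
  assumes M: "1 \<le> M" "M \<le> r" and t: "1 \<le> t" "t \<le> r" "r \<le> t ^ 2"
  shows "(t + 1) * (r - M choose t) + M * (r - 1 choose (t - 1)) \<le> t * (r choose t)"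
proof (cases "M = r")
  case True
  then show ?thesis
    using t times_binomial_minus1_eq[of t r] by (simp add: binomial_eq_0)
next
  case False
  then have Mr: "M < r" "r > 1" using M by auto
  let ?b = "r choose t"
  have 1: "(r - 1) * (r - M choose t) \<le> (r - M) * (r - 1 choose t)"
    using binomial_ratio_mono[of "r - M" "r - 1" t] M t by simp
  have 2: "r * (r - 1 choose t) = (r - t) * ?b"
    using binomial_absorb_comp[of r t] by simp
  have 3: "r * (r - 1 choose (t - 1)) = t * ?b"
    using t times_binomial_minus1_eq[of t r] by simp
  \<comment> \<open>Equivalent to \<open>r \<le> t ^ 2\<close>: the source of the square in the
    cover-free property.\<close>
  have 4: "(t + 1) * (r - t) \<le> t * (r - 1)"
  proof -
    have "r - t \<le> t * (t - 1)"
      using t by (simp add: power2_eq_square diff_mult_distrib2)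
    moreover have "t * (r - t) + t * (t - 1) = t * (r - 1)"
      using t by (simp flip: add_mult_distrib2)
    ultimately show ?thesis by simp
  qed
  have "(r * (r - 1)) * ((t + 1) * (r - M choose t) + M * (r - 1 choose (t - 1)))
      = (t + 1) * r * ((r - 1) * (r - M choose t)) + (r - 1) * M * (r * (r - 1 choose (t - 1)))"
    by (subst add_mult_distrib2) (simp only: mult.assoc mult.commute mult.left_commute)
  also have "\<dots> \<le> (t + 1) * r * ((r - M) * (r - 1 choose t)) + (r - 1) * M * (t * ?b)"
    unfolding 3 by (intro add_mono mult_le_mono2 1) simp
  also have "(t + 1) * r * ((r - M) * (r - 1 choose t)) = (r - M) * ?b * ((t + 1) * (r - t))"
  proof -
    have "(t + 1) * r * ((r - M) * (r - 1 choose t)) = (t + 1) * (r - M) * (r * (r - 1 choose t))"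
      by (simp only: mult.assoc mult.commute mult.left_commute)
    then show ?thesis unfolding 2 by (simp only: mult.assoc mult.commute mult.left_commute)
  qed
  also have "\<dots> \<le> (r - M) * ?b * (t * (r - 1))"
    using 4 by (rule mult_le_mono2)
  also have "(r - M) * ?b * (t * (r - 1)) + (r - 1) * M * (t * ?b) = (r - 1) * t * ?b * ((r - M) + M)"
    by (simp only: add_mult_distrib2 mult.assoc mult.commute mult.left_commute)
  also have "\<dots> = (r * (r - 1)) * (t * ?b)" using M by (simp add: mult_ac)
  finally show ?thesis using Mr by simp
qed

lemma card_Int_eq_sum:
  "finite A \<Longrightarrow> card (A \<inter> B) = (\<Sum>x\<in>A. if x \<in> B then 1 else 0)"
  by (simp add: sum.If_cases)

lemma card_Collect_split:
  assumes "finite A"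
  shows "card A = card {x \<in> A. P x} + card {x \<in> A. \<not> P x}"
proof -
  have "A = {x \<in> A. P x} \<union> {x \<in> A. \<not> P x}" by auto
  then show ?thesis using assms by (metis (no_types, lifting) card_Un_disjoint disjoint_iff finite_Un mem_Collect_eq)
qed

text \<open>\<open>TS_intersection_bound\<close>, summed over all \<open>t\<close>-subsets of a
  cover of \<open>B\<close> and counted point by point, contradicts
  \<open>binomial_cover_inequality\<close>: the sum is strict.\<close>

theorem TS_imp_cover_free:
  assumes TS: "traceability_scheme t w v X \<B>" and w: "w > 0"
  shows "cover_free (t ^ 2) \<B>"
  unfolding cover_free_def
proof (intro ballI allI impI notI)
  note D = TS_D[OF TS]
  fix B I assume B: "B \<in> \<B>" and I: "I \<subseteq> \<B> - {B} \<and> finite I \<and> card I \<le> t ^ 2" and sub: "B \<subseteq> \<Union>I"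
  have finB: "finite B" "card B = w" using D(3)[OF B] by auto
  let ?r = "card I"
  have "I \<noteq> {}" using sub finB w by auto
  then have r1: "?r \<ge> 1" using I by (metis card_0_eq less_one not_less)
  then have t1: "t \<ge> 1" using I by (cases t) auto
  show False
  proof (cases "?r \<le> t")
    case True
    \<comment> \<open>For a cover by at most \<open>t\<close> blocks, \<open>B\<close> itself is the
      untraceable \<open>w\<close>-set.\<close>
    obtain B' where "B' \<in> I" "card (B \<inter> B) < card (B \<inter> B')"
      using D(4)[of I B B] I r1 True sub finB B by blast
    then show False using card_mono[of B "B \<inter> B'"] finB by auto
  next
    case False
    then have tr: "t \<le> ?r" by simp
    let ?N = "[I]\<^bsup>t\<^esup>"
    have finN: "finite ?N" using I by (intro finite_imp_finite_nsets) auto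
    have cN: "card ?N = ?r choose t" by (rule card_nsets)
    have Npos: "?N \<noteq> {}" using cN tr by (metis card.empty zero_less_binomial less_irrefl)
    define M where "M p = card {B' \<in> I. p \<in> B'}" for p
    have Mle: "M p \<le> ?r" for p unfolding M_def using I by (intro card_mono) auto
    have M1: "1 \<le> M p" if "p \<in> B" for p
    proof -
      have "{B' \<in> I. p \<in> B'} \<noteq> {}" using sub that by auto
      then show ?thesis unfolding M_def using I by (simp add: Suc_leI card_gt_0_iff)
    qed
    have each: "(t + 1) * card (B \<inter> \<Union>S) < w + (\<Sum>B'\<in>S. card (B \<inter> B'))" if "S \<in> ?N" for S
    proof -
      have "S \<subseteq> I" "card S = t" using that by (auto simp: nsets_def)
      then show ?thesis using TS_intersection_bound[OF TS B, of S] I t1 by auto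
    qed
    \<comment> \<open>Incidences of points \<open>p\<close> with unions, counted through the
      \<open>t\<close>-subsets missing \<open>p\<close>: these avoid all the \<open>M p\<close>
      blocks on \<open>p\<close>.\<close>
    have s1: "(\<Sum>S\<in>?N. card (B \<inter> \<Union>S)) + (\<Sum>p\<in>B. (?r - M p) choose t) = w * (?r choose t)"
    proof -
      have "card {S \<in> ?N. p \<in> \<Union>S} + ((?r - M p) choose t) = ?r choose t" for p
      proof -
        have "{S \<in> ?N. p \<notin> \<Union>S} = [I - {B' \<in> I. p \<in> B'}]\<^bsup>t\<^esup>"
          by (auto simp: nsets_def)
        moreover have "card (I - {B' \<in> I. p \<in> B'}) = ?r - M p"
          unfolding M_def using I by (intro card_Diff_subset) auto
        ultimately have "card {S \<in> ?N. p \<notin> \<Union>S} = (?r - M p) choose t"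
          by (simp only: card_nsets)
        moreover have "card ?N = card {S \<in> ?N. p \<in> \<Union>S} + card {S \<in> ?N. p \<notin> \<Union>S}"
          by (rule card_Collect_split[OF finN])
        ultimately show ?thesis using cN by simp
      qed
      moreover have "(\<Sum>S\<in>?N. card (B \<inter> \<Union>S)) = (\<Sum>p\<in>B. card {S \<in> ?N. p \<in> \<Union>S})"
      proof -
        have "(\<Sum>S\<in>?N. card (B \<inter> \<Union>S)) = (\<Sum>S\<in>?N. \<Sum>p\<in>B. if p \<in> \<Union>S then 1 else 0)"
          using finB by (simp only: card_Int_eq_sum)
        also have "\<dots> = (\<Sum>p\<in>B. \<Sum>S\<in>?N. if p \<in> \<Union>S then 1 else 0)" by (rule sum.swap)
        also have "\<dots> = (\<Sum>p\<in>B. card {S \<in> ?N. p \<in> \<Union>S})"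
          using finN by (intro sum.cong) (auto simp: sum.If_cases Int_def)
        finally show ?thesis .
      qed
      ultimately show ?thesis
        using finB by (simp add: sum.distrib[symmetric])
    qed
    \<comment> \<open>Triples with \<open>p \<in> B'\<close> and \<open>B' \<in> S\<close>: each
      block lies in \<open>?r - 1 choose (t - 1)\<close> of the \<open>t\<close>-subsets.\<close>
    have s2: "(\<Sum>S\<in>?N. \<Sum>B'\<in>S. card (B \<inter> B')) = (\<Sum>p\<in>B. M p * (?r - 1 choose (t - 1)))"
    proof -
      have cnt: "card {S \<in> ?N. B' \<in> S} = (?r - 1 choose (t - 1))" if "B' \<in> I" for B'
      proof -
        have "{S \<in> ?N. B' \<notin> S} = [I - {B'}]\<^bsup>t\<^esup>" by (auto simp: nsets_def)
        then have "card {S \<in> ?N. B' \<notin> S} = (?r - 1) choose t"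
          using that I by (simp add: card_nsets)
        moreover have "card ?N = card {S \<in> ?N. B' \<in> S} + card {S \<in> ?N. B' \<notin> S}"
          by (rule card_Collect_split[OF finN])
        moreover have "?r choose t = (?r - 1 choose (t - 1)) + (?r - 1 choose t)"
          using r1 t1 by (simp add: choose_reduce_nat)
        ultimately show ?thesis using cN by simp
      qed
      have "(\<Sum>S\<in>?N. \<Sum>B'\<in>S. card (B \<inter> B')) = (\<Sum>S\<in>?N. \<Sum>B'\<in>I. if B' \<in> S then card (B \<inter> B') else 0)"
      proof (rule sum.cong)
        fix S assume "S \<in> ?N"
        then have "I \<inter> S = S" by (auto simp: nsets_def)
        then show "(\<Sum>B'\<in>S. card (B \<inter> B')) = (\<Sum>B'\<in>I. if B' \<in> S then card (B \<inter> B') else 0)"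
          using I by (simp add: sum.If_cases)
      qed simp
      also have "\<dots> = (\<Sum>B'\<in>I. \<Sum>S\<in>?N. if B' \<in> S then card (B \<inter> B') else 0)" by (rule sum.swap)
      also have "\<dots> = (\<Sum>B'\<in>I. card (B \<inter> B') * (?r - 1 choose (t - 1)))"
        using finN cnt by (intro sum.cong) (auto simp: sum.If_cases Int_def)
      also have "\<dots> = (\<Sum>B'\<in>I. card (B \<inter> B')) * (?r - 1 choose (t - 1))"
        by (simp add: sum_distrib_right)
      also have "(\<Sum>B'\<in>I. card (B \<inter> B')) = (\<Sum>B'\<in>I. \<Sum>p\<in>B. if p \<in> B' then 1 else 0)"
        using finB by (simp only: card_Int_eq_sum)
      also have "\<dots> = (\<Sum>p\<in>B. \<Sum>B'\<in>I. if p \<in> B' then 1 else 0)" by (rule sum.swap)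
      also have "\<dots> = (\<Sum>p\<in>B. M p)"
        using I by (intro sum.cong) (auto simp: sum.If_cases Int_def M_def)
      finally show ?thesis by (simp add: sum_distrib_right)
    qed
    have "(\<Sum>S\<in>?N. (t + 1) * card (B \<inter> \<Union>S)) < (\<Sum>S\<in>?N. w + (\<Sum>B'\<in>S. card (B \<inter> B')))"
      by (rule sum_strict_mono[OF finN Npos each])
    then have lt: "(t + 1) * (\<Sum>S\<in>?N. card (B \<inter> \<Union>S)) <
        w * (?r choose t) + (\<Sum>p\<in>B. M p * (?r - 1 choose (t - 1)))"
      unfolding sum_distrib_left[symmetric] sum.distrib s2 using cN by (simp add: mult.commute)
    have "(\<Sum>p\<in>B. (t + 1) * (?r - M p choose t) + M p * (?r - 1 choose (t - 1))) \<le> (\<Sum>p\<in>B. t * (?r choose t))"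
      by (intro sum_mono binomial_cover_inequality) (use M1 Mle t1 tr I in auto)
    then have "(t + 1) * (\<Sum>p\<in>B. (?r - M p choose t)) + (\<Sum>p\<in>B. M p * (?r - 1 choose (t - 1))) \<le> t * (w * (?r choose t))"
      using finB by (simp add: sum.distrib sum_distrib_left mult.left_commute)
    moreover have "(t + 1) * (\<Sum>S\<in>?N. card (B \<inter> \<Union>S)) + (t + 1) * (\<Sum>p\<in>B. (?r - M p choose t)) = (t + 1) * (w * (?r choose t))"
      using s1 by (metis add_mult_distrib2)
    ultimately show False using lt by (simp add: algebra_simps)
  qed
qed

section \<open>Graphs without large matchings\<close>

lemma card_Union_pairs:
  assumes "finite M" "\<And>e. e \<in> M \<Longrightarrow> card e = 2" "pairwise disjnt M"
  shows "card (\<Union>M) = 2 * card M"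
proof -
  have "card (\<Union>M) = (\<Sum>e\<in>M. card e)"
    by (rule card_Union_disjoint) (use assms card.infinite in fastforce)+
  then show ?thesis using assms(2) by simp
qed

lemma pairwise_disjnt_insert_iff:
  "e \<notin> M \<Longrightarrow> pairwise disjnt (insert e M) \<longleftrightarrow> pairwise disjnt M \<and> e \<inter> \<Union>M = {}"
  by (auto simp: pairwise_insert disjnt_def)

lemma pairwise_disjnt_same:
  "pairwise disjnt M \<Longrightarrow> e \<in> M \<Longrightarrow> f \<in> M \<Longrightarrow> x \<in> e \<Longrightarrow> x \<in> f \<Longrightarrow> e = f"
  unfolding pairwise_def disjnt_iff by blast

text \<open>Gallai's lemma: "no maximum matching misses both \<open>u\<close> and \<open>v\<close>" is transitive in \<open>u\<close>, \<open>v\<close>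
  as soon as every vertex is missed by some maximum matching.\<close>

lemma gallai_transitive:
  fixes V :: "'a set" and d :: nat
  defines "mm \<equiv> \<lambda>E M. M \<subseteq> E \<and> pairwise disjnt M \<and> card M = d"
  assumes V: "finite V" "E \<subseteq> [V]\<^bsup>2\<^esup>"
    and max: "\<And>M. M \<subseteq> E \<Longrightarrow> pairwise disjnt M \<Longrightarrow> card M \<le> d"
    and avoid: "\<exists>M. mm E M \<and> w \<notin> \<Union>M"
    and uw: "\<And>M. mm E M \<Longrightarrow> u \<in> \<Union>M \<or> w \<in> \<Union>M"
    and wv: "\<And>M. mm E M \<Longrightarrow> w \<in> \<Union>M \<or> v \<in> \<Union>M"
    and uv: "u \<noteq> v" and M: "mm E M"
  shows "u \<in> \<Union>M \<or> v \<in> \<Union>M"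
proof (rule ccontr)
  assume "\<not> ?thesis"
  then have uM: "u \<notin> \<Union>M" "v \<notin> \<Union>M" by auto
  have finE: "finite E" using finite_imp_finite_nsets[OF V(1)] V(2) by (rule finite_subset[rotated])
  have e2: "card e = 2" if "e \<in> E" for e using that V(2) by (auto simp: nsets_def)
  \<comment> \<open>Among the maximum matchings missing \<open>w\<close>, \<open>N\<close> will
    share the most edges with \<open>M\<close>.\<close>
  let ?S = "{N. mm E N \<and> w \<notin> \<Union>N}"
  have finS: "finite ?S"
    by (rule finite_subset[of _ "Pow E"]) (use finE in \<open>auto simp: mm_def\<close>)
  have "?S \<noteq> {}" using avoid by auto
  let ?A = "(\<lambda>N. card (M \<inter> N)) ` ?S"
  have "Max ?A \<in> ?A" by (rule Max_in) (use finS \<open>?S \<noteq> {}\<close> in auto)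
  then obtain N where N: "mm E N" "w \<notin> \<Union>N" and Nm: "Max ?A = card (M \<inter> N)" by auto
  have Nmax: "card (M \<inter> N') \<le> card (M \<inter> N)" if "mm E N'" "w \<notin> \<Union>N'" for N'
    unfolding Nm[symmetric] by (rule Max_ge) (use finS that in auto)
  have fin: "finite M" "finite N" using M N finE by (auto simp: mm_def intro: finite_subset)
  have c: "card (\<Union>L) = 2 * d" "finite (\<Union>L)" if "mm E L" for L
  proof -
    have L: "L \<subseteq> E" "pairwise disjnt L" "card L = d" "finite L"
      using that finE by (auto simp: mm_def intro: finite_subset)
    show "card (\<Union>L) = 2 * d" using card_Union_pairs[of L] L e2 by blast
    have "\<Union>L \<subseteq> V" using L(1) V(2) by (auto simp: nsets_def)
    then show "finite (\<Union>L)" using V(1) by (rule finite_subset)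
  qed
  \<comment> \<open>As \<open>N\<close> misses \<open>w\<close>, it covers both \<open>u\<close> and
    \<open>v\<close>, which \<open>M\<close> misses. Both cover \<open>2 * d\<close> vertices, so
    \<open>M\<close> covers at least two that \<open>N\<close> misses, and one of these is not
    \<open>w\<close>.\<close>
  have "card {u, v} \<le> card (\<Union>N - \<Union>M)"
    by (rule card_mono) (use c[OF N(1)] uM N uw[OF N(1)] wv[OF N(1)] in auto)
  also have "\<dots> = card (\<Union>M - \<Union>N)"
    using c[OF M] c[OF N(1)] by (simp add: card_Diff_subset_Int Int_commute)
  finally have "2 \<le> card (\<Union>M - \<Union>N)" using uv by simp
  then have "\<not> \<Union>M - \<Union>N \<subseteq> {w}"
    using card_mono[of "{w}" "\<Union>M - \<Union>N"] by auto
  then obtain x where x: "x \<in> \<Union>M" "x \<notin> \<Union>N" "x \<noteq> w" by auto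
  then obtain e where e: "e \<in> M" "x \<in> e" by auto
  then have eE: "e \<in> E" using M by (auto simp: mm_def)
  obtain y where exy: "e = {x, y}" "x \<noteq> y"
    using e2[OF eE] e(2) by (auto simp: card_2_iff doubleton_eq_iff)
  have eN: "e \<notin> N" using e(2) x(2) by auto
  have yN: "y \<in> \<Union>N"
  proof (rule ccontr)
    assume "y \<notin> \<Union>N"
    then have "pairwise disjnt (insert e N)"
      using N(1) x(2) exy eN by (subst pairwise_disjnt_insert_iff) (auto simp: mm_def)
    then have "card (insert e N) \<le> d" using N(1) eE by (intro max) (auto simp: mm_def)
    then show False using eN fin N(1) by (simp add: mm_def)
  qed
  then obtain f where f: "f \<in> N" "y \<in> f" by auto
  have fM: "f \<notin> M"
  proof
    assume "f \<in> M"
    then have "f = e"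
      using pairwise_disjnt_same[of M f e y] M e(1) f(2) exy(1) by (simp add: mm_def)
    then show False using f(1) eN by simp
  qed
  \<comment> \<open>Exchanging \<open>f\<close> for \<open>e\<close> still avoids \<open>w\<close>
    and gains an edge in common with \<open>M\<close>, against the choice of
    \<open>N\<close>.\<close>
  let ?N' = "insert e (N - {f})"
  have pd: "pairwise disjnt (N - {f})"
    by (rule pairwise_subset[of _ N]) (use N(1) in \<open>auto simp: mm_def\<close>)
  have "y \<notin> g" if "g \<in> N - {f}" for g
    using pairwise_disjnt_same[of N g f y] that f N(1) by (auto simp: mm_def)
  then have pd': "pairwise disjnt ?N'"
    using pd x(2) exy eN by (subst pairwise_disjnt_insert_iff) auto
  have "card ?N' = d"
  proof -
    have "0 < card N" using fin f(1) by (auto simp: card_gt_0_iff)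
    then show ?thesis using fin eN f(1) N(1) by (simp add: mm_def)
  qed
  with pd' N(1) eE have N': "mm E ?N'" by (auto simp: mm_def)
  moreover have "w \<notin> \<Union>?N'" using N(2) x(3) yN exy by auto
  ultimately have "card (M \<inter> ?N') \<le> card (M \<inter> N)" by (rule Nmax)
  moreover have "M \<inter> ?N' = insert e (M \<inter> N)" using e(1) fM by auto
  ultimately show False using fin eN by simp
qed

text \<open>By \<open>gallai_transitive\<close> the vertices fall into classes such that a maximum
  matching misses at most one vertex of each, while every edge lies within a class. A class with m
  matching edges inside has at most 2m + 1 vertices, hence at most m(2m + 1) edges, and the numbers
  m add up to at most \<open>d\<close>.\<close>

lemma gallai_edge_bound:
  fixes V :: "'a set"
  assumes V: "finite V" "E \<subseteq> [V]\<^bsup>2\<^esup>"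
    and max: "\<And>M. M \<subseteq> E \<Longrightarrow> pairwise disjnt M \<Longrightarrow> card M \<le> d"
    and avoid: "\<And>x. x \<in> V \<Longrightarrow> \<exists>M. M \<subseteq> E \<and> pairwise disjnt M \<and> card M = d \<and> x \<notin> \<Union>M"
  shows "card E \<le> d * (2 * d + 1)"
proof (cases "V = {}")
  case True
  then have "E = {}" using V(2) by (auto simp: nsets_def)
  then show ?thesis by simp
next
  case False
  define mm where "mm M \<longleftrightarrow> M \<subseteq> E \<and> pairwise disjnt M \<and> card M = d" for M
  obtain M where M: "mm M" using False avoid by (auto simp: mm_def)
  have finE: "finite E" using finite_imp_finite_nsets[OF V(1)] V(2) by (rule finite_subset[rotated])
  have e2: "card e = 2" "e \<subseteq> V" if "e \<in> E" for e using that V(2) by (auto simp: nsets_def)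
  define r where "r = {(u, v). u \<in> V \<and> v \<in> V \<and> (u = v \<or> (\<forall>M. mm M \<longrightarrow> u \<in> \<Union>M \<or> v \<in> \<Union>M))}"
  have r: "equiv V r"
  proof (rule equivI)
    show "r \<subseteq> V \<times> V" by (auto simp: r_def)
    show "refl_on V r" by (auto simp: r_def refl_on_def)
    show "sym r" by (auto simp: r_def sym_def)
    show "trans r"
    proof (rule transI)
      fix u w v assume uw: "(u, w) \<in> r" and wv: "(w, v) \<in> r"
      show "(u, v) \<in> r"
      proof (cases "u = w \<or> w = v \<or> u = v")
        case True
        then show ?thesis using uw wv by (auto simp: r_def)
      next
        case F: False
        have "u \<in> \<Union>M' \<or> v \<in> \<Union>M'" if "mm M'" for M'
          by (rule gallai_transitive[OF V max, where w = w and u = u and v = v and M = M'])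
            (use avoid[of w] uw wv F that in \<open>auto simp: r_def mm_def\<close>)
        then show ?thesis using uw wv by (auto simp: r_def)
      qed
    qed
  qed
  \<comment> \<open>An edge with both ends missed could be added to the matching.\<close>
  have edge_r: "(u, v) \<in> r" if uv: "{u, v} \<in> E" for u v
  proof -
    have "u \<in> \<Union>M \<or> v \<in> \<Union>M" if "mm M" for M
    proof (rule ccontr)
      assume "\<not> ?thesis"
      moreover from this have "{u, v} \<notin> M" by auto
      ultimately have "pairwise disjnt (insert {u, v} M)"
        using that by (subst pairwise_disjnt_insert_iff) (auto simp: mm_def)
      then have "card (insert {u, v} M) \<le> d"
        using that uv by (intro max) (auto simp: mm_def)
      moreover have "finite M" using that finE by (auto simp: mm_def intro: finite_subset)
      ultimately show False using \<open>{u, v} \<notin> M\<close> that by (simp add: mm_def)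
    qed
    then show ?thesis using e2(2)[OF uv] by (auto simp: r_def)
  qed
  define Q where "Q = V // r"
  have Q: "finite Q" "\<Union>Q = V" "\<And>C D. C \<in> Q \<Longrightarrow> D \<in> Q \<Longrightarrow> C = D \<or> C \<inter> D = {}"
    unfolding Q_def using r V(1) equiv_type[OF r]
    by (auto simp: Union_quotient[OF r] quotient_disj[OF r] intro: finite_quotient)
  have Qfin: "finite C" "C \<subseteq> V" if "C \<in> Q" for C using Q(2) V(1) that
    by (auto intro: finite_subset)
  have in_class: "\<exists>C\<in>Q. e \<subseteq> C" if eE: "e \<in> E" for e
  proof -
    obtain u v where uv: "e = {u, v}" using e2(1)[OF eE] by (auto simp: card_2_iff)
    then have "(u, v) \<in> r" using edge_r eE by simp
    moreover have "u \<in> V" using e2(2)[OF eE] uv by simp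
    ultimately show ?thesis
      unfolding Q_def uv using equiv_class_self[OF r]
      by (intro bexI[of _ "r `` {u}"]) (auto intro: quotientI)
  qed
  define m where "m C = card {f \<in> M. f \<subseteq> C}" for C
  have finM: "finite M" and ME: "M \<subseteq> E" and Md: "pairwise disjnt M" and cM: "card M = d"
    using M finE by (auto simp: mm_def intro: finite_subset)
  have size: "card C \<le> 2 * m C + 1" if C: "C \<in> Q" for C
  proof -
    have U: "C \<inter> \<Union>M = \<Union>{f \<in> M. f \<subseteq> C}"
    proof
      show "C \<inter> \<Union>M \<subseteq> \<Union>{f \<in> M. f \<subseteq> C}"
      proof
        fix x assume "x \<in> C \<inter> \<Union>M"
        then obtain f where f: "x \<in> C" "x \<in> f" "f \<in> M" by auto
        then obtain D where "D \<in> Q" "f \<subseteq> D" using in_class ME by blast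
        then have "D = C" using Q(3)[OF _ C] f by blast
        then show "x \<in> \<Union>{f \<in> M. f \<subseteq> C}" using f \<open>f \<subseteq> D\<close> by auto
      qed
    qed auto
    have "card (C \<inter> \<Union>M) = 2 * m C"
      unfolding U m_def
      by (rule card_Union_pairs) (use finM ME e2 Md in \<open>auto simp: pairwise_def\<close>)
    moreover have "card (C - \<Union>M) \<le> 1"
    proof -
      have "x = y" if "x \<in> C - \<Union>M" "y \<in> C - \<Union>M" for x y
      proof -
        have "(x, y) \<in> r" using that C r unfolding Q_def
          by (meson DiffE in_quotient_imp_in_rel insert_subset empty_subsetI)
        then show ?thesis using that M by (auto simp: r_def)
      qed
      then show ?thesis
        using Qfin[OF C] by (metis One_nat_def card_le_Suc0_iff_eq finite_Diff)
    qed
    moreover have "card C = card (C \<inter> \<Union>M) + card (C - \<Union>M)"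
      using Qfin(1)[OF C] by (rule card_Int_Diff)
    ultimately show ?thesis by linarith
  qed
  have msum: "(\<Sum>C\<in>Q. m C) \<le> d"
  proof -
    have "(\<Sum>C\<in>Q. m C) = card (\<Union>C\<in>Q. {f \<in> M. f \<subseteq> C})"
      unfolding m_def
    proof (rule card_UN_disjoint[symmetric])
      show "\<forall>C\<in>Q. \<forall>D\<in>Q. C \<noteq> D \<longrightarrow> {f \<in> M. f \<subseteq> C} \<inter> {f \<in> M. f \<subseteq> D} = {}"
      proof (intro ballI impI)
        fix C D assume CD: "C \<in> Q" "D \<in> Q" "C \<noteq> D"
        have "f \<noteq> {}" if "f \<in> M" for f using that ME e2 by fastforce
        then show "{f \<in> M. f \<subseteq> C} \<inter> {f \<in> M. f \<subseteq> D} = {}"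
          using Q(3)[OF CD(1,2)] CD(3) by blast
      qed
    qed (use Q(1) finM in auto)
    also have "\<dots> \<le> card M" by (rule card_mono) (use finM in auto)
    finally show ?thesis using cM by simp
  qed
  have "card E \<le> card (\<Union>C\<in>Q. [C]\<^bsup>2\<^esup>)"
  proof (rule card_mono)
    show "finite (\<Union>C\<in>Q. [C]\<^bsup>2\<^esup>)" using Q(1) Qfin(1) finite_imp_finite_nsets by blast
    show "E \<subseteq> (\<Union>C\<in>Q. [C]\<^bsup>2\<^esup>)"
      using in_class e2 by (force simp: nsets_def intro: card_ge_0_finite)
  qed
  also have "\<dots> \<le> (\<Sum>C\<in>Q. card ([C]\<^bsup>2\<^esup>))" by (rule card_UN_le[OF Q(1)])
  also have "\<dots> \<le> (\<Sum>C\<in>Q. m C * (2 * d + 1))"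
  proof (rule sum_mono)
    fix C assume C: "C \<in> Q"
    have "card ([C]\<^bsup>2\<^esup>) = card C choose 2" by (rule card_nsets)
    also have "\<dots> \<le> (2 * m C + 1) choose 2" by (rule binomial_right_mono[OF size[OF C]])
    also have "\<dots> = m C * (2 * m C + 1)" by (simp add: choose_two)
    also have "\<dots> \<le> m C * (2 * d + 1)"
      using msum member_le_sum[of C Q m] C Q(1) by simp
    finally show "card ([C]\<^bsup>2\<^esup>) \<le> m C * (2 * d + 1)" .
  qed
  also have "\<dots> = (\<Sum>C\<in>Q. m C) * (2 * d + 1)" by (rule sum_distrib_right[symmetric])
  also have "\<dots> \<le> d * (2 * d + 1)" using msum by (rule mult_le_mono1)
  finally show ?thesis .
qed

text \<open>The number \<open>d * (d + 2 * q + 1)\<close> is twice the number of pairs meeting a set of \<open>d\<close> vertices.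
  The assumption \<open>3 * d + 2 \<le> 2 * q\<close> makes a complete graph on \<open>2 * d + 1\<close> vertices, which has no
  \<open>d + 1\<close> disjoint edges either, smaller than that.\<close>

lemma erdos_gallai:
  fixes V :: "'a set"
  assumes "finite V" "card V = q + 1 + d" "E \<subseteq> [V]\<^bsup>2\<^esup>" "3 * d + 2 \<le> 2 * q"
    and "\<And>M. M \<subseteq> E \<Longrightarrow> pairwise disjnt M \<Longrightarrow> card M \<le> d"
  shows "2 * card E \<le> d * (d + 2 * q + 1) \<and>
    (2 * card E = d * (d + 2 * q + 1) \<longrightarrow>
       (\<exists>D \<subseteq> V. card D = d \<and> E = {e \<in> [V]\<^bsup>2\<^esup>. e \<inter> D \<noteq> {}}))"
  using assms
proof (induction d arbitrary: V E)
  case 0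
  have "E = {}"
  proof (rule ccontr)
    assume "E \<noteq> {}"
    then obtain e where "e \<in> E" by auto
    then have "card {e} \<le> 0" by (intro "0.prems"(5)) (auto simp: pairwise_def)
    then show False by simp
  qed
  then show ?case by (auto intro!: exI[of _ "{}"])
next
  case (Suc d)
  note V = Suc.prems(1-3) and max = Suc.prems(5)
  have finE: "finite E" using finite_imp_finite_nsets[OF V(1)] V(3) by (rule finite_subset[rotated])
  show ?case
  \<comment> \<open>Either some vertex meets every matching of \<open>Suc d\<close> edges, and is
    deleted for the induction, or each vertex is missed by such a matching, as
    \<open>gallai_edge_bound\<close> demands.\<close>
  proof (cases "\<exists>x\<in>V. \<forall>M. M \<subseteq> {e \<in> E. x \<notin> e} \<longrightarrow> pairwise disjnt M \<longrightarrow> card M \<le> d")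
    case True
    then obtain x where x: "x \<in> V"
      and xm: "\<And>M. M \<subseteq> {e \<in> E. x \<notin> e} \<Longrightarrow> pairwise disjnt M \<Longrightarrow> card M \<le> d" by auto
    let ?E' = "{e \<in> E. x \<notin> e}" and ?Ex = "{e \<in> E. x \<in> e}" and ?S = "(\<lambda>y. {x, y}) ` (V - {x})"
    have IH: "2 * card ?E' \<le> d * (d + 2 * q + 1) \<and>
      (2 * card ?E' = d * (d + 2 * q + 1) \<longrightarrow>
       (\<exists>D \<subseteq> V - {x}. card D = d \<and> ?E' = {e \<in> [V - {x}]\<^bsup>2\<^esup>. e \<inter> D \<noteq> {}}))"
      by (rule Suc.IH) (use V Suc.prems(4) x xm in \<open>auto simp: nsets_def\<close>)
    have "card E = card (?E' \<union> ?Ex)" by (rule arg_cong[of _ _ card]) auto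
    also have "\<dots> = card ?E' + card ?Ex" by (rule card_Un_disjoint) (use finE in auto)
    finally have cE: "card E = card ?E' + card ?Ex" .
    have sub: "?Ex \<subseteq> ?S"
    proof
      fix e assume "e \<in> ?Ex"
      then have "card e = 2" "e \<subseteq> V" "x \<in> e" using V(3) by (auto simp: nsets_def)
      then show "e \<in> ?S" by (auto simp: card_2_iff doubleton_eq_iff)
    qed
    have cS: "card ?S = q + 1 + d"
      using V x by (subst card_image) (auto intro!: inj_onI simp: doubleton_eq_iff)
    have finS: "finite ?S" using V(1) by simp
    have cEx: "card ?Ex \<le> q + 1 + d" using card_mono[OF finS sub] cS by simp
    have c2: "2 * card E \<le> 2 * card ?E' + 2 * (q + 1 + d)"
      using cE cEx by simp
    have id: "d * (d + 2 * q + 1) + 2 * (q + 1 + d) = Suc d * (Suc d + 2 * q + 1)"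
      by (simp add: algebra_simps)
    show ?thesis
    proof (intro conjI impI)
      show "2 * card E \<le> Suc d * (Suc d + 2 * q + 1)"
        using conjunct1[OF IH] c2 id by simp
      \<comment> \<open>Equality leaves no slack: \<open>x\<close> is joined to all other vertices,
        and the remaining graph is extremal with a set \<open>D\<close>, to which \<open>x\<close>
        is added.\<close>
      assume eq: "2 * card E = Suc d * (Suc d + 2 * q + 1)"
      then have "2 * card ?E' = d * (d + 2 * q + 1)" and cx: "card ?Ex = q + 1 + d"
        using conjunct1[OF IH] c2 cE cEx unfolding id[symmetric] by simp_all
      then obtain D where D: "D \<subseteq> V - {x}" "card D = d" "?E' = {e \<in> [V - {x}]\<^bsup>2\<^esup>. e \<inter> D \<noteq> {}}"
        using IH by blast
      have Ex: "?Ex = ?S" by (rule card_subset_eq[OF finS sub]) (use cx cS in simp)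
      have finD: "finite D" using D(1) V(1) by (auto intro: finite_subset)
      have Eq: "E = {e \<in> [V]\<^bsup>2\<^esup>. e \<inter> insert x D \<noteq> {}}"
      proof (intro Set.set_eqI iffI)
        fix e assume e: "e \<in> E"
        then have "e \<in> [V]\<^bsup>2\<^esup>" using V(3) by auto
        moreover have "e \<inter> insert x D \<noteq> {}"
        proof (cases "x \<in> e")
          case False
          then have "e \<in> ?E'" using e by simp
          then show ?thesis unfolding D(3) by auto
        qed auto
        ultimately show "e \<in> {e \<in> [V]\<^bsup>2\<^esup>. e \<inter> insert x D \<noteq> {}}" by simp
      next
        fix e assume e: "e \<in> {e \<in> [V]\<^bsup>2\<^esup>. e \<inter> insert x D \<noteq> {}}"
        then have e2: "card e = 2" "e \<subseteq> V" "finite e" by (auto simp: nsets_def)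
        show "e \<in> E"
        proof (cases "x \<in> e")
          case True
          then have "e \<in> ?S" using e2 by (auto simp: card_2_iff doubleton_eq_iff)
          then show ?thesis using Ex by blast
        next
          case False
          then have "e \<in> {e \<in> [V - {x}]\<^bsup>2\<^esup>. e \<inter> D \<noteq> {}}" using e e2 by (auto simp: nsets_def)
          then show ?thesis using D(3) by blast
        qed
      qed
      show "\<exists>D \<subseteq> V. card D = Suc d \<and> E = {e \<in> [V]\<^bsup>2\<^esup>. e \<inter> D \<noteq> {}}"
      proof (intro exI conjI)
        show "insert x D \<subseteq> V" using D(1) x by auto
        have "x \<notin> D" using D(1) by auto
        then show "card (insert x D) = Suc d" using finD D(2) by simp
      qed (rule Eq)
    qed
  next
    case False
    have "\<exists>M. M \<subseteq> E \<and> pairwise disjnt M \<and> card M = Suc d \<and> x \<notin> \<Union>M" if x: "x \<in> V" for x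
    proof -
      obtain M where M: "M \<subseteq> {e \<in> E. x \<notin> e}" "pairwise disjnt M" "card M > d"
        using False x by (meson not_le)
      then have "card M = Suc d" using max[of M] by force
      then show ?thesis using M by (intro exI[of _ M]) auto
    qed
    note avoid = this
    have "card E \<le> Suc d * (2 * Suc d + 1)"
      by (rule gallai_edge_bound[OF V(1,3) max avoid])
    then have "2 * card E \<le> Suc d * (4 * d + 6)" by (simp add: algebra_simps)
    also have "\<dots> < Suc d * (Suc d + 2 * q + 1)"
      by (rule mult_strict_left_mono) (use Suc.prems(4) in auto)
    finally show ?thesis by simp
  qed
qed

section \<open>The upper bound\<close>

text \<open>For the meaning of the letters see \<open>steiner_bound\<close>; \<open>e\<close> is
  \<open>card W\<close>, \<open>g\<close> is \<open>2 * m * card G\<close>, and \<open>U\<close>,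
  \<open>U'\<close> count points not joined to a chosen one, \<open>U'\<close> only those outside
  nonperfect blocks. The first two assumptions give e + E < dv. With \<open>eW\<close> this bounds
  \<open>E\<close> by d(1 + s), and \<open>cH\<close> bounds \<open>s\<close> in terms of
  \<open>E\<close>; for large \<open>v\<close> the two resolve to bounds in \<open>d\<close> alone.
  Then \<open>U'\<close> is close to \<open>v\<close>, and \<open>eW\<close> contradicts e <
  dv.\<close>

lemma large_order_contradiction:
  fixes v d e E m g s k U U' :: int
  assumes total: "2 * e + g + 2 * E = v * (v - 1)"
    and large: "(v - d) * (v - d - 1) < g"
    and cH: "v * s \<le> 2 * (e + m * E + E)"
    and cU: "U + 1 + s = v"
    and NPpts: "U \<le> U' + E * k"
    and eW: "2 * d * U + U' \<le> 2 * e"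
    and v1: "3 * d * (2 * m) \<le> v"
    and v2: "12 * d\<^sup>2 + 10 * d + 2 + 3 * d * (1 + 2 * d) * k \<le> 2 * v"
    and pos: "d \<ge> 1" "v \<ge> 1" "E \<ge> 0" "U' \<ge> 0" "k \<ge> 0" "s \<ge> 0"
  shows False
proof -
  have "v * (v - 1) - (v - d) * (v - d - 1) = 2 * (d * v) - d * d - d"
    by (simp add: algebra_simps)
  moreover have "d * d \<ge> 0" by simp
  ultimately have B: "2 * e + 2 * E < 2 * (d * v)" using total large pos by linarith
  have U: "U = v - 1 - s" using cU by simp
  have "2 * (d * v) - 2 * (d * (1 + s)) + U' \<le> 2 * e"
    using eW unfolding U by (simp add: algebra_simps)
  then have E1: "E \<le> d * (1 + s)" using B pos by linarith
  have C: "v * s \<le> 2 * (d * v) + 2 * (m * E)" using cH B by (simp add: algebra_simps)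
  have mE: "3 * (d * (2 * (m * E))) \<le> v * E"
    using mult_right_mono[OF v1 pos(3)] by (simp add: algebra_simps)
  have "v * E \<le> v * (d * (1 + s))" using E1 pos by (intro mult_left_mono) auto
  also have "\<dots> = d * v + d * (v * s)" by (simp add: algebra_simps)
  also have "\<dots> \<le> d * v + d * (2 * (d * v) + 2 * (m * E))"
    using C pos by (intro add_left_mono mult_left_mono) auto
  finally have "v * E \<le> d * v + 2 * (d * (d * v)) + d * (2 * (m * E))" by (simp add: algebra_simps)
  then have "2 * (v * E) \<le> 3 * (d * v) + 6 * (d * (d * v))" using mE by linarith
  then have "v * (2 * E) \<le> v * (3 * d + 6 * (d * d))" by (simp add: algebra_simps)
  \<comment> \<open>From here on \<open>E\<close>, and below also \<open>s\<close>, is bounded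
    independently of \<open>v\<close>.\<close>
  then have E2: "2 * E \<le> 3 * d + 6 * (d * d)" using pos by (simp add: mult_le_cancel_left)
  have s3: "s \<le> 3 * d"
  proof -
    have "3 * (d * (v * s)) \<le> 3 * (d * (2 * (d * v) + 2 * (m * E)))"
      using C pos by (intro mult_left_mono) auto
    also have "\<dots> = 6 * (d * (d * v)) + 3 * (d * (2 * (m * E)))" by (simp add: algebra_simps)
    also have "\<dots> \<le> 6 * (d * (d * v)) + v * E" using mE by simp
    finally have "v * (3 * (d * s)) \<le> v * (6 * (d * d) + E)" by (simp add: algebra_simps)
    then have "3 * (d * s) \<le> 6 * (d * d) + E" using pos by (simp add: mult_le_cancel_left)
    then have "6 * (d * s) \<le> 18 * (d * d) + 3 * d" using E2 by linarith
    then have "d * (6 * s) \<le> d * (18 * d + 3)" by (simp add: algebra_simps)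
    then have "6 * s \<le> 18 * d + 3" using pos by (simp add: mult_le_cancel_left)
    then show ?thesis by linarith
  qed
  have "d * (1 + s) \<le> d * (1 + 3 * d)" using s3 pos by (intro mult_left_mono) auto
  moreover have "d * (1 + 3 * d) = d + 3 * (d * d)" by (simp add: algebra_simps)
  ultimately have ds: "d * (1 + s) \<le> d + 3 * (d * d)" by linarith
  have "2 * (d * v) - 2 * (d * (1 + s)) + (v - 1 - s - E * k) < 2 * (d * v)"
    using eW NPpts B pos unfolding U by (simp add: algebra_simps)
  then have "v < 2 * (d * (1 + s)) + 1 + s + E * k" by linarith
  then have lt: "2 * v < 12 * (d * d) + 10 * d + 2 + (2 * E) * k" using ds s3 by linarith
  have "(2 * E) * k \<le> (3 * d + 6 * (d * d)) * k" using E2 pos by (intro mult_right_mono) auto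
  also have "(3 * d + 6 * (d * d)) * k = 3 * d * (1 + 2 * d) * k" by (simp add: algebra_simps)
  finally show False using lt v2 by (simp add: power2_eq_square)
qed

text \<open>The right-hand side exceeds \<open>(N - y) * (N - y - 1)\<close> by (2N - y - 1)y, where
  the first factor is at least N - 1. Thus \<open>y\<close> blocks, each set aside together with a
  point, are paid for by the points lost.\<close>

lemma quadratic_removal_bound:
  fixes m y N :: nat
  assumes "y \<le> N" "m + 1 \<le> N"
  shows "m * y + (N - y) * (N - y - 1) \<le> N * (N - 1)"
proof -
  have i: "int ((N - y) * (N - y - 1)) = (int N - int y) * (int N - int y - 1)"
    using assms(1) by (cases "N = y") (auto simp: of_nat_diff)
  have "int m * int y \<le> (2 * int N - int y - 1) * int y"
    using assms by (intro mult_right_mono) auto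
  then have "int (m * y + (N - y) * (N - y - 1)) \<le> int N * (int N - 1)"
    using i by (simp add: algebra_simps)
  also have "\<dots> = int (N * (N - 1))" using assms(2) by (simp add: of_nat_diff)
  finally show ?thesis by (simp only: of_nat_le_iff)
qed

text \<open>The difference of the two products is (2v - d - y - 1)(y - d), and y < 2(y - d). When
  this many points are lost, the weaker estimate for the other blocks suffices.\<close>

lemma quadratic_removal_bound':
  fixes m y v d :: nat
  assumes "2 * d < y" "y \<le> v" "2 * m + d + 1 \<le> v"
  shows "m * y + (v - y) * (v - y - 1) \<le> (v - d) * (v - d - 1)"
proof -
  have i: "int ((v - y) * (v - y - 1)) = (int v - int y) * (int v - int y - 1)"
    using assms(2) by (cases "v = y") (auto simp: of_nat_diff)
  have j: "int ((v - d) * (v - d - 1)) = (int v - int d) * (int v - int d - 1)"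
    using assms by (simp add: of_nat_diff)
  have "2 * (int m * int y) = (2 * int m) * int y" by simp
  also have "\<dots> \<le> (2 * int m) * (2 * (int y - int d))"
    using assms by (intro mult_left_mono) auto
  also have "\<dots> = 2 * ((2 * int m) * (int y - int d))" by simp
  also have "\<dots> \<le> 2 * ((2 * int v - int d - int y - 1) * (int y - int d))"
    using assms by (intro mult_left_mono mult_right_mono) auto
  finally have "int m * int y \<le> (2 * int v - int d - int y - 1) * (int y - int d)" by simp
  then have "int (m * y + (v - y) * (v - y - 1)) \<le> int ((v - d) * (v - d - 1))"
    using i j by (simp add: algebra_simps)
  then show ?thesis by (simp only: of_nat_le_iff)
qed

text \<open>The size conditions of \<open>steiner_bound\<close> hold from q^3 on if d = 1 and from
  q^4 on if d is larger, hence the exponent. Writing q = r + 4 leaves inequalities between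
  polynomials in \<open>r\<close> that hold coefficientwise.\<close>

lemma large_order_conditions:
  fixes q d v :: nat
  assumes q: "q \<ge> 4" and d: "d \<ge> 1" "3 * d + 2 \<le> 2 * q" and v: "q ^ (2 + min 2 d) \<le> v"
  shows "3 * d * (q * (q + 1)) \<le> v"
    "12 * d\<^sup>2 + 10 * d + 2 + 3 * d * (1 + 2 * d) * (q + 1 + d) \<le> 2 * v"
proof -
  obtain r where r: "q = r + 4" using q by (metis add.commute le_Suc_ex)
  have "3 * d * (q * (q + 1)) \<le> v \<and>
    12 * d\<^sup>2 + 10 * d + 2 + 3 * d * (1 + 2 * d) * (q + 1 + d) \<le> 2 * v"
  proof (cases "d = 1")
    case True
    then have "q ^ 3 \<le> v" using v by (simp add: numeral_3_eq_3)
    moreover have "3 * d * (q * (q + 1)) \<le> q ^ 3"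
      unfolding True r by (simp add: power3_eq_cube algebra_simps)
    moreover have "12 * d\<^sup>2 + 10 * d + 2 + 3 * d * (1 + 2 * d) * (q + 1 + d) \<le> 2 * q ^ 3"
      unfolding True r by (simp add: power3_eq_cube algebra_simps)
    ultimately show ?thesis by linarith
  next
    case False
    then have "q ^ 4 \<le> v" using v d by (simp add: min_def)
    let ?D = "2 * r + 6"
    have D: "3 * d \<le> ?D" using d(2) r by simp
    have "3 * d * (q * (q + 1)) \<le> ?D * (q * (q + 1))" using D by (rule mult_le_mono1)
    also have "\<dots> \<le> q ^ 4" unfolding r by (simp add: power4_eq_xxxx algebra_simps)
    finally have 1: "3 * d * (q * (q + 1)) \<le> q ^ 4" .
    \<comment> \<open>The factor 9 makes the expression a polynomial in \<open>3 * d\<close>, for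
      which the bound \<open>?D\<close> can be inserted.\<close>
    have "9 * (12 * d\<^sup>2 + 10 * d + 2 + 3 * d * (1 + 2 * d) * (q + 1 + d))
       = 12 * ((3 * d) * (3 * d)) + 30 * (3 * d) + 18 + (3 * d) * (3 + 2 * (3 * d)) * (3 * q + 3 + 3 * d)"
      by (simp add: power2_eq_square algebra_simps)
    also have "\<dots> \<le> 12 * (?D * ?D) + 30 * ?D + 18 + ?D * (3 + 2 * ?D) * (3 * q + 3 + ?D)"
      by (intro add_mono mult_le_mono order.refl D)
    also have "\<dots> \<le> 9 * (2 * q ^ 4)"
      unfolding r by (simp add: power4_eq_xxxx algebra_simps)
    finally have "12 * d\<^sup>2 + 10 * d + 2 + 3 * d * (1 + 2 * d) * (q + 1 + d) \<le> 2 * q ^ 4" by simp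
    then show ?thesis using 1 \<open>q ^ 4 \<le> v\<close> by linarith
  qed
  then show "3 * d * (q * (q + 1)) \<le> v"
    "12 * d\<^sup>2 + 10 * d + 2 + 3 * d * (1 + 2 * d) * (q + 1 + d) \<le> 2 * v" by auto
qed

lemma two_choose_two: "2 * (n choose 2) = n * (n - 1)"
  using times_binomial_minus1_eq[of 2 n] by simp

definition nbrs :: "'a set set \<Rightarrow> 'a \<Rightarrow> 'a set" where
  "nbrs G z = {u. u \<noteq> z \<and> {z, u} \<in> G}"

lemma nbrs_sym: "u \<in> nbrs G z \<longleftrightarrow> z \<in> nbrs G u"
  by (auto simp: nbrs_def insert_commute)

lemma handshake:
  assumes "finite X" "G \<subseteq> [X]\<^bsup>2\<^esup>"
  shows "(\<Sum>z\<in>X. card (nbrs G z)) = 2 * card G"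
proof -
  have finG: "finite G" using finite_imp_finite_nsets[OF assms(1)] assms(2) by (rule finite_subset[rotated])
  have e2: "e \<subseteq> X" "card e = 2" if "e \<in> G" for e using that assms(2) by (auto simp: nsets_def)
  have deg: "card (nbrs G z) = card {e \<in> G. z \<in> e}" for z
  proof (rule bij_betw_same_card[of "\<lambda>u. {z, u}"])
    have "\<exists>u\<in>nbrs G z. e = {z, u}" if "e \<in> G" "z \<in> e" for e
      using e2(2)[OF that(1)] that by (auto simp: card_2_iff nbrs_def insert_commute)
    then show "bij_betw (\<lambda>u. {z, u}) (nbrs G z) {e \<in> G. z \<in> e}"
      unfolding bij_betw_def by (auto simp: inj_on_def doubleton_eq_iff nbrs_def)
  qed
  have "(\<Sum>z\<in>X. card {e \<in> G. z \<in> e}) = (\<Sum>z\<in>X. \<Sum>e\<in>G. if z \<in> e then 1 else 0)"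
    using finG by (simp add: sum.If_cases Int_def)
  also have "\<dots> = (\<Sum>e\<in>G. \<Sum>z\<in>X. if z \<in> e then 1 else 0)" by (rule sum.swap)
  also have "\<dots> = (\<Sum>e\<in>G. 2)"
  proof (rule sum.cong)
    fix e assume e: "e \<in> G"
    then have "X \<inter> e = e" using e2(1) by auto
    then show "(\<Sum>z\<in>X. if z \<in> e then 1 else 0) = (2::nat)"
      using assms(1) e2(2)[OF e] by (simp add: sum.If_cases)
  qed simp
  finally show ?thesis using deg by simp
qed

lemma nbrs_subset: "G \<subseteq> [X]\<^bsup>2\<^esup> \<Longrightarrow> nbrs G z \<subseteq> X"
  by (auto simp: nbrs_def nsets_def)

section \<open>Own pairs of the blocks\<close>

text \<open>In the application, \<open>G\<close> is what remains of \<open>F\<close> without the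
  blocks having a point in no other block, and \<open>X\<close> lacks one such point for each of
  these. Coverings and own pairs still refer to all of \<open>F\<close>.\<close>

locale cover_free_blocks =
  fixes F G :: "'a set set" and X :: "'a set" and q d :: nat
  assumes cf: "cover_free q F" and finF: "finite F"
    and GF: "G \<subseteq> F" and GX: "\<And>B. B \<in> G \<Longrightarrow> B \<subseteq> X" and finX: "finite X"
    and card_block: "\<And>B. B \<in> G \<Longrightarrow> card B = q + 1 + d"
    and no_own_point: "\<And>B x. B \<in> G \<Longrightarrow> x \<in> B \<Longrightarrow> \<exists>B'\<in>F - {B}. x \<in> B'"
    and dq: "3 * d + 2 \<le> 2 * q"
begin

definition own :: "'a set \<Rightarrow> 'a set set" where
  "own B = {e \<in> [B]\<^bsup>2\<^esup>. \<forall>B'\<in>F. e \<subseteq> B' \<longrightarrow> B' = B}"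

definition W :: "'a set set" where
  "W = [X]\<^bsup>2\<^esup> - \<Union>(own ` G)"

lemma finB: "B \<in> G \<Longrightarrow> finite B"
  using GX finX by (meson finite_subset)

lemma finG: "finite G" using finF GF by (rule finite_subset[rotated])

lemma own_subset: "B \<in> G \<Longrightarrow> own B \<subseteq> [X]\<^bsup>2\<^esup>"
  using GX nsets_mono[of B X 2] by (auto simp: own_def)

lemma fin_own: "B \<in> G \<Longrightarrow> finite (own B)"
  using own_subset finite_imp_finite_nsets[OF finX] by (rule finite_subset)

lemma own_disjoint: "B \<in> G \<Longrightarrow> B' \<in> G \<Longrightarrow> B \<noteq> B' \<Longrightarrow> own B \<inter> own B' = {}"
  using GF by (auto simp: own_def nsets_def)

text \<open>Such a pair lies in two different blocks of \<open>F\<close>, hence is own for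
  none.\<close>

lemma not_own_W:
  assumes "B \<in> G" "e \<in> [B]\<^bsup>2\<^esup>" "e \<notin> own B"
  shows "e \<in> W"
proof -
  obtain B' where B': "B' \<in> F" "e \<subseteq> B'" "B' \<noteq> B" using assms by (auto simp: own_def)
  have eB: "e \<subseteq> B" using assms(2) by (auto simp: nsets_def)
  have "e \<notin> own B''" if "B'' \<in> G" for B''
  proof
    assume "e \<in> own B''"
    then have "C = B''" if "C \<in> F" "e \<subseteq> C" for C using that by (simp add: own_def)
    from this[of B] this[of B'] show False using eB B' assms(1) GF by blast
  qed
  moreover have "e \<in> [X]\<^bsup>2\<^esup>" using assms(2) GX[OF assms(1)] nsets_mono[of B X 2] by auto
  ultimately show ?thesis by (auto simp: W_def)
qed

text \<open>\<open>d + 1\<close> disjoint pairs in \<open>B\<close>, none of them own, together with the \<open>q - d - 1\<close> points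
  outside of them, would cover \<open>B\<close> by \<open>q\<close> other blocks.\<close>

lemma matching_bound:
  assumes B: "B \<in> G" and M: "M \<subseteq> [B]\<^bsup>2\<^esup> - own B" "pairwise disjnt M"
  shows "card M \<le> d"
proof (rule ccontr)
  assume "\<not> card M \<le> d"
  then have "d + 1 \<le> card M" by simp
  then obtain N where N: "N \<subseteq> M" "card N = d + 1" "finite N"
    by (rule obtain_subset_with_card_n)
  have Ne: "card e = 2" "e \<subseteq> B" if "e \<in> N" for e
    using that N(1) M(1) by (auto simp: nsets_def)
  have "\<exists>B'. B' \<in> F - {B} \<and> e \<subseteq> B'" if "e \<in> N" for e
  proof -
    have "e \<in> [B]\<^bsup>2\<^esup> - own B" using that N(1) M(1) by blast
    then show ?thesis by (auto simp: own_def)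
  qed
  note exf = this
  define f where "f e = (SOME B'. B' \<in> F - {B} \<and> e \<subseteq> B')" for e
  have f: "f e \<in> F - {B} \<and> e \<subseteq> f e" if "e \<in> N" for e
    unfolding f_def by (rule someI_ex[OF exf[OF that]])
  have exg: "\<exists>B'. B' \<in> F - {B} \<and> x \<in> B'" if "x \<in> B" for x
    using no_own_point[OF B that] by blast
  define g where "g x = (SOME B'. B' \<in> F - {B} \<and> x \<in> B')" for x
  have g: "g x \<in> F - {B} \<and> x \<in> g x" if "x \<in> B" for x
    unfolding g_def by (rule someI_ex[OF exg[OF that]])
  have UN: "\<Union>N \<subseteq> B" using Ne by auto
  have cUN: "card (\<Union>N) = 2 * (d + 1)"
    using card_Union_pairs[OF N(3) Ne(1) pairwise_subset[OF M(2) N(1)]] N(2) by simp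
  have fins: "finite (B - \<Union>N)" using finB[OF B] by simp
  let ?S = "f ` N \<union> g ` (B - \<Union>N)"
  have "card ?S \<le> card (f ` N) + card (g ` (B - \<Union>N))" by (rule card_Un_le)
  also have "\<dots> \<le> card N + card (B - \<Union>N)"
    by (intro add_mono card_image_le N(3) fins)
  also have "card (B - \<Union>N) = q + 1 + d - 2 * (d + 1)"
    using card_Diff_subset[OF finite_subset[OF UN finB[OF B]] UN] cUN card_block[OF B] by simp
  \<comment> \<open>The union of the pairs lies in \<open>B\<close>, so the subtraction is not
    truncated.\<close>
  also have "card N + (q + 1 + d - 2 * (d + 1)) = q"
    using card_mono[OF finB[OF B] UN] unfolding cUN card_block[OF B] N(2) by simp
  finally have "card ?S \<le> q" .
  moreover have "finite ?S" using N(3) fins by simp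
  moreover have "?S \<subseteq> F - {B}" using f g by blast
  moreover have "B \<subseteq> \<Union>?S"
  proof
    fix x assume x: "x \<in> B"
    show "x \<in> \<Union>?S"
    proof (cases "x \<in> \<Union>N")
      case True
      then obtain e where "e \<in> N" "x \<in> e" by blast
      then show ?thesis using f[of e] by blast
    next
      case False
      then show ?thesis using x g[OF x] by blast
    qed
  qed
  moreover have "B \<in> F" using B GF by blast
  ultimately show False using cf[unfolded cover_free_def, rule_format, of B ?S] by simp
qed

text \<open>By \<open>matching_bound\<close>, \<open>erdos_gallai\<close> applies to the pairs of
  \<open>B\<close> that are not own. The complementary count in a block of \<open>q + 1 + d\<close>
  points is \<open>q * (q + 1)\<close> after doubling.\<close>

lemma own_card:
  assumes B: "B \<in> G"
  shows "q * (q + 1) \<le> 2 * card (own B)"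
    "2 * card (own B) = q * (q + 1) \<Longrightarrow>
      \<exists>D \<subseteq> B. card D = d \<and> [B]\<^bsup>2\<^esup> - own B = {e \<in> [B]\<^bsup>2\<^esup>. e \<inter> D \<noteq> {}}"
proof -
  let ?E = "[B]\<^bsup>2\<^esup> - own B"
  have eg: "2 * card ?E \<le> d * (d + 2 * q + 1)"
    "2 * card ?E = d * (d + 2 * q + 1) \<Longrightarrow> \<exists>D \<subseteq> B. card D = d \<and> ?E = {e \<in> [B]\<^bsup>2\<^esup>. e \<inter> D \<noteq> {}}"
    using erdos_gallai[OF finB[OF B] card_block[OF B] _ dq matching_bound[OF B], of ?E] by blast+
  have sub: "own B \<subseteq> [B]\<^bsup>2\<^esup>" by (auto simp: own_def)
  have "card ?E + card (own B) = card ([B]\<^bsup>2\<^esup>)"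
    using card_Diff_subset[OF fin_own[OF B] sub] card_mono[OF _ sub] finite_imp_finite_nsets[OF finB[OF B]] by simp
  then have "2 * card ?E + 2 * card (own B) = 2 * ((q + 1 + d) choose 2)"
    using card_block[OF B] by (simp add: card_nsets)
  also have "\<dots> = d * (d + 2 * q + 1) + q * (q + 1)"
    unfolding two_choose_two by (simp add: algebra_simps)
  finally have eq: "2 * card ?E + 2 * card (own B) = d * (d + 2 * q + 1) + q * (q + 1)" .
  show "q * (q + 1) \<le> 2 * card (own B)" using eq eg(1) by linarith
  show "\<exists>D \<subseteq> B. card D = d \<and> ?E = {e \<in> [B]\<^bsup>2\<^esup>. e \<inter> D \<noteq> {}}"
    if "2 * card (own B) = q * (q + 1)"
    using eq that by (intro eg(2)) linarith
qed

lemma W_count: "card W + (\<Sum>B\<in>G. card (own B)) = card X choose 2"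
proof -
  have "(\<Sum>B\<in>G. card (own B)) = card (\<Union>(own ` G))"
    by (rule card_UN_disjoint[symmetric]) (use finG fin_own own_disjoint in auto)
  moreover have sub: "\<Union>(own ` G) \<subseteq> [X]\<^bsup>2\<^esup>" using own_subset by blast
  moreover have "card W = card ([X]\<^bsup>2\<^esup>) - card (\<Union>(own ` G))"
    unfolding W_def by (rule card_Diff_subset) (use finG fin_own sub in auto)
  moreover have "card (\<Union>(own ` G)) \<le> card ([X]\<^bsup>2\<^esup>)"
    by (rule card_mono[OF finite_imp_finite_nsets[OF finX] sub])
  ultimately show ?thesis by (simp add: card_nsets)
qed

text \<open>Own pairs of different blocks are different. This weaker estimate serves when
  \<open>d = 0\<close> or many blocks have been set aside.\<close>

lemma plain_bound: "q * (q + 1) * card G \<le> card X * (card X - 1)"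
proof -
  have "q * (q + 1) * card G = (\<Sum>B\<in>G. q * (q + 1))" by simp
  also have "\<dots> \<le> (\<Sum>B\<in>G. 2 * card (own B))" by (intro sum_mono own_card(1))
  also have "\<dots> \<le> 2 * (card X choose 2)" using W_count by (simp flip: sum_distrib_left)
  finally show ?thesis unfolding two_choose_two .
qed

text \<open>The nonperfect blocks; a perfect one attains equality in \<open>own_card\<close> and so
  has a distinguished \<open>d\<close>-set.\<close>

definition NP :: "'a set set" where
  "NP = {B \<in> G. 2 * card (own B) \<noteq> q * (q + 1)}"

lemma perfect:
  assumes "B \<in> G" "B \<notin> NP"
  obtains D where "D \<subseteq> B" "card D = d"
    "\<And>e. e \<in> [B]\<^bsup>2\<^esup> \<Longrightarrow> e \<inter> D \<noteq> {} \<Longrightarrow> e \<in> W" "\<And>e. e \<in> own B \<Longrightarrow> e \<inter> D = {}"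
proof -
  obtain D where D: "D \<subseteq> B" "card D = d" "[B]\<^bsup>2\<^esup> - own B = {e \<in> [B]\<^bsup>2\<^esup>. e \<inter> D \<noteq> {}}"
    using own_card(2)[OF assms(1)] assms by (auto simp: NP_def)
  have "e \<in> W" if "e \<in> [B]\<^bsup>2\<^esup>" "e \<inter> D \<noteq> {}" for e
  proof -
    have "e \<in> [B]\<^bsup>2\<^esup> - own B" unfolding D(3) using that by simp
    then show ?thesis using not_own_W[OF assms(1)] by blast
  qed
  moreover have "e \<inter> D = {}" if "e \<in> own B" for e
  proof (rule ccontr)
    assume "e \<inter> D \<noteq> {}"
    moreover have "e \<in> [B]\<^bsup>2\<^esup>" using that by (simp add: own_def)
    ultimately have "e \<in> [B]\<^bsup>2\<^esup> - own B" unfolding D(3) by simp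
    then show False using that by simp
  qed
  ultimately show thesis using D(1,2) that by blast
qed

text \<open>An own pair avoids the \<open>d\<close>-set \<open>D\<close> of its perfect block, while
  \<open>W\<close> joins every other point of the block to all of \<open>D\<close>.\<close>

lemma perfect_pair:
  assumes "B \<in> G" "B \<notin> NP" "{z, u} \<in> own B" "z \<noteq> u"
  obtains D where "D \<subseteq> B" "card D = d" "z \<in> B - D" "u \<in> B - D" "D \<subseteq> nbrs W z" "D \<subseteq> nbrs W u"
    "\<And>e. e \<in> [B]\<^bsup>2\<^esup> \<Longrightarrow> e \<inter> D \<noteq> {} \<Longrightarrow> e \<in> W"
proof -
  obtain D where D: "D \<subseteq> B" "card D = d"
    "\<And>e. e \<in> [B]\<^bsup>2\<^esup> \<Longrightarrow> e \<inter> D \<noteq> {} \<Longrightarrow> e \<in> W" "\<And>e. e \<in> own B \<Longrightarrow> e \<inter> D = {}"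
    using perfect[OF assms(1,2)] by blast
  have zu: "z \<in> B - D" "u \<in> B - D" using D(4)[OF assms(3)] assms(3) by (auto simp: own_def nsets_def)
  have "D \<subseteq> nbrs W y" if y: "y \<in> B - D" for y
  proof
    fix x assume x: "x \<in> D"
    then have ne: "x \<noteq> y" using y by auto
    then have "{y, x} \<in> [B]\<^bsup>2\<^esup>" using x y D(1) by (auto simp: nsets_def)
    then show "x \<in> nbrs W y" using D(3)[of "{y, x}"] x ne by (auto simp: nbrs_def)
  qed
  with D zu that show thesis by blast
qed

end

section \<open>The common \<open>d\<close>-set of the extremal blocks\<close>

context cover_free_blocks
begin

text \<open>Pairs outside \<open>H\<close> are own for perfect blocks. Hence a point of small degree
  in \<open>H\<close> is joined to most points by own pairs of perfect blocks.\<close>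

definition H :: "'a set set" where
  "H = W \<union> \<Union>(own ` NP)"

lemma NP_G: "NP \<subseteq> G" by (auto simp: NP_def)

lemma W_sub: "W \<subseteq> [X]\<^bsup>2\<^esup>"
  by (auto simp: W_def)

lemma H_sub: "H \<subseteq> [X]\<^bsup>2\<^esup>"
  using W_sub own_subset NP_G by (fastforce simp: H_def)

lemma perfect_or_H:
  assumes "z \<in> X" "u \<in> X" "z \<noteq> u" "u \<notin> nbrs H z"
  shows "\<exists>B\<in>G - NP. {z, u} \<in> own B"
proof -
  have "{z, u} \<in> [X]\<^bsup>2\<^esup>" using assms by (auto simp: nsets_def)
  moreover have "{z, u} \<notin> H" using assms by (auto simp: nbrs_def)
  ultimately show ?thesis by (auto simp: H_def W_def)
qed

lemma finite_nbrs: "finite (nbrs W z)" "finite (nbrs H z)"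
  using finX nbrs_subset[OF W_sub] nbrs_subset[OF H_sub] by (meson finite_subset)+

text \<open>A vertex outside the nonperfect blocks with only \<open>d\<close> neighbours in \<open>W\<close> forces all the blocks
  through it to be extremal with the same \<open>d\<close>-set.\<close>

lemma bound_if_low_degree:
  assumes u: "u \<in> X" "u \<notin> \<Union>NP" "card (nbrs W u) = d" and v: "card X > d + 1"
  shows "q * (q + 1) * card G \<le> (card X - d) * (card X - d - 1)"
proof -
  let ?D = "nbrs W u"
  have Dsub: "?D \<subseteq> X" by (rule nbrs_subset[OF W_sub])
  have uD: "u \<notin> ?D" by (simp add: nbrs_def)
  have block: "\<exists>B. z \<in> B \<and> ?D \<subseteq> B \<and> (\<forall>e\<in>[B]\<^bsup>2\<^esup>. e \<inter> ?D \<noteq> {} \<longrightarrow> e \<in> W)"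
    if z: "z \<in> X" "z \<noteq> u" "z \<notin> ?D" for z
  proof -
    have "z \<notin> nbrs H u"
    proof
      assume "z \<in> nbrs H u"
      then obtain B where B: "B \<in> NP" "{u, z} \<in> own B"
        using z by (auto simp: nbrs_def H_def)
      then have "u \<in> B" by (auto simp: own_def nsets_def)
      then show False using B(1) u(2) by blast
    qed
    then obtain B where B: "B \<in> G" "B \<notin> NP" "{u, z} \<in> own B"
      using perfect_or_H[of u z] z u(1) by blast
    obtain D where D: "D \<subseteq> B" "card D = d" "u \<in> B - D" "z \<in> B - D" "D \<subseteq> nbrs W u"
      "\<And>e. e \<in> [B]\<^bsup>2\<^esup> \<Longrightarrow> e \<inter> D \<noteq> {} \<Longrightarrow> e \<in> W"
      using perfect_pair[OF B(1,2,3)] z(2) by blast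
    \<comment> \<open>\<open>D\<close> consists of neighbours of \<open>u\<close>, of which there
      are only \<open>d\<close>, so it does not depend on \<open>z\<close>.\<close>
    have "D = ?D" by (rule card_subset_eq[OF finite_nbrs(1) D(5)]) (use D(2) u(3) in simp)
    then show ?thesis using D by (intro exI[of _ B]) blast
  qed
  have "card (insert u ?D) = d + 1" using uD finite_nbrs u(3) by simp
  then have "\<not> X \<subseteq> insert u ?D"
    using v card_mono[of "insert u ?D" X] finite_nbrs(1)[of u] by auto
  \<comment> \<open>The block through \<open>u\<close> and \<open>z0\<close> contains all of
    \<open>?D\<close>; it serves for the pairs inside \<open>?D\<close>.\<close>
  then obtain z0 where z0: "z0 \<in> X" "z0 \<noteq> u" "z0 \<notin> ?D" by blast
  have in_W: "{x, y} \<in> W" if x: "x \<in> ?D" and y: "y \<in> X" "y \<noteq> x" for x y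
  proof -
    consider "y = u" | "y \<noteq> u" "y \<notin> ?D" | "y \<in> ?D" by blast
    then show ?thesis
    proof cases
      case 1
      then show ?thesis using x by (simp add: nbrs_def insert_commute)
    next
      case 2
      then obtain B where B: "y \<in> B" "?D \<subseteq> B" "\<forall>e\<in>[B]\<^bsup>2\<^esup>. e \<inter> ?D \<noteq> {} \<longrightarrow> e \<in> W"
        using block[OF y(1)] by blast
      then have "{x, y} \<in> [B]\<^bsup>2\<^esup>" using x y(2) by (auto simp: nsets_def)
      then show ?thesis using B(3)[rule_format, of "{x, y}"] x by blast
    next
      case 3
      obtain B where B: "?D \<subseteq> B" "\<forall>e\<in>[B]\<^bsup>2\<^esup>. e \<inter> ?D \<noteq> {} \<longrightarrow> e \<in> W"
        using block[OF z0] by blast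
      then have "{x, y} \<in> [B]\<^bsup>2\<^esup>" using x y(2) 3 by (auto simp: nsets_def)
      then show ?thesis using B(2)[rule_format, of "{x, y}"] x by blast
    qed
  qed
  \<comment> \<open>All pairs meeting \<open>?D\<close> are in \<open>W\<close>, so the own pairs
    live on the \<open>card X - d\<close> other points.\<close>
  have own_sub: "\<Union>(own ` G) \<subseteq> [X - ?D]\<^bsup>2\<^esup>"
  proof
    fix e assume e: "e \<in> \<Union>(own ` G)"
    then have e2: "e \<in> [X]\<^bsup>2\<^esup>" "e \<notin> W" using own_subset by (auto simp: W_def)
    have "e \<inter> ?D = {}"
    proof (rule ccontr)
      assume "e \<inter> ?D \<noteq> {}"
      then obtain x where x: "x \<in> e" "x \<in> ?D" by auto
      obtain y where "e = {x, y}" "y \<noteq> x"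
        using e2(1) x(1) by (auto simp: nsets_def card_2_iff)
      moreover from this have "y \<in> X" using e2(1) by (auto simp: nsets_def)
      ultimately show False using in_W[OF x(2)] e2(2) by simp
    qed
    then show "e \<in> [X - ?D]\<^bsup>2\<^esup>" using e2(1) by (auto simp: nsets_def)
  qed
  have "q * (q + 1) * card G = (\<Sum>B\<in>G. q * (q + 1))" by simp
  also have "\<dots> \<le> (\<Sum>B\<in>G. 2 * card (own B))" by (intro sum_mono own_card(1))
  also have "\<dots> = 2 * (\<Sum>B\<in>G. card (own B))" by (simp add: sum_distrib_left)
  also have "(\<Sum>B\<in>G. card (own B)) = card (\<Union>(own ` G))"
    by (rule card_UN_disjoint[symmetric]) (use finG fin_own own_disjoint in auto)
  also have "\<dots> \<le> card ([X - ?D]\<^bsup>2\<^esup>)"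
    by (rule card_mono[OF _ own_sub]) (use finX finite_imp_finite_nsets in blast)
  also have "card ([X - ?D]\<^bsup>2\<^esup>) = (card X - d) choose 2"
    using card_Diff_subset[OF finite_nbrs(1) Dsub] u(3) by (simp add: card_nsets)
  finally show ?thesis using two_choose_two[of "card X - d"] by simp
qed

text \<open>A point not joined to \<open>z\<close> in \<open>H\<close> has \<open>d\<close> neighbours among those of \<open>z\<close>.  So, in the sum of the
  degrees, \<open>d\<close> per such point comes from these points and as much again from the neighbours of \<open>z\<close>.\<close>

lemma edges_ge:
  assumes z: "z \<in> X"
    and high: "\<And>u. u \<in> X \<Longrightarrow> u \<notin> \<Union>NP \<Longrightarrow> card (nbrs W u) \<noteq> d"
  shows "2 * d * card (X - {z} - nbrs H z) + card (X - {z} - nbrs H z - \<Union>NP) \<le> 2 * card W"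
proof -
  let ?U = "X - {z} - nbrs H z" and ?S = "nbrs W z"
  \<comment> \<open>As \<open>W\<close> is part of \<open>H\<close>, the sets \<open>?S\<close> and
    \<open>?U\<close> are disjoint and their degrees may be added.\<close>
  have S: "?S \<subseteq> X" "?S \<subseteq> nbrs H z"
    using nbrs_subset[OF W_sub] by (auto simp: nbrs_def H_def)
  have dU: "d \<le> card (nbrs W u \<inter> ?S)" if u: "u \<in> ?U" for u
  proof -
    obtain B where B: "B \<in> G" "B \<notin> NP" "{z, u} \<in> own B"
      using perfect_or_H[of z u] u z by blast
    obtain D where "card D = d" "D \<subseteq> nbrs W z" "D \<subseteq> nbrs W u"
      using perfect_pair[OF B] u by blast
    then show ?thesis
      using card_mono[of "nbrs W u \<inter> ?S" D] finite_nbrs(1) by auto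
  qed
  have dU': "d \<le> card (nbrs W u)" if "u \<in> ?U" for u
    using dU[OF that] card_mono[of "nbrs W u" "nbrs W u \<inter> ?S"] finite_nbrs(1)[of u] by auto
  \<comment> \<open>Outside the nonperfect blocks the degree is at least \<open>d\<close> and, by
    \<open>high\<close>, not \<open>d\<close>.\<close>
  have deg: "d + (if u \<in> \<Union>NP then 0 else 1) \<le> card (nbrs W u)" if "u \<in> ?U" for u
    using dU'[OF that] high[of u] that by auto
  have fins: "finite ?U" "finite ?S" using finX finite_nbrs by auto
  have "d * card ?U \<le> (\<Sum>u\<in>?U. card (nbrs W u \<inter> ?S))"
    using sum_mono[of ?U "\<lambda>_. d", OF dU] by (simp add: mult.commute)
  also have "\<dots> = (\<Sum>u\<in>?U. \<Sum>x\<in>?S. if x \<in> nbrs W u then 1 else 0)"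
    using card_Int_eq_sum[OF fins(2)] by (simp add: Int_commute)
  also have "\<dots> = (\<Sum>x\<in>?S. \<Sum>u\<in>?U. if u \<in> nbrs W x then 1 else 0)"
    by (subst sum.swap) (simp add: nbrs_sym)
  also have "\<dots> = (\<Sum>x\<in>?S. card (?U \<inter> nbrs W x))"
    using card_Int_eq_sum[OF fins(1)] by simp
  also have "\<dots> \<le> (\<Sum>x\<in>?S. card (nbrs W x))"
    by (intro sum_mono card_mono finite_nbrs) auto
  finally have 1: "d * card ?U \<le> (\<Sum>x\<in>?S. card (nbrs W x))" .
  have "(\<Sum>u\<in>?U. if u \<in> \<Union>NP then 0 else 1) = (\<Sum>u\<in>?U - \<Union>NP. (1::nat))"
    by (rule sum.mono_neutral_cong_right) (use fins in auto)
  then have "d * card ?U + card (?U - \<Union>NP) = (\<Sum>u\<in>?U. d + (if u \<in> \<Union>NP then 0 else 1))"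
    by (simp only: sum.distrib sum_constant card_eq_sum[symmetric] of_nat_id mult.commute)
  also have "\<dots> \<le> (\<Sum>u\<in>?U. card (nbrs W u))" by (intro sum_mono deg)
  finally have 2: "d * card ?U + card (?U - \<Union>NP) \<le> (\<Sum>u\<in>?U. card (nbrs W u))" .
  have "(\<Sum>u\<in>?U. card (nbrs W u)) + (\<Sum>x\<in>?S. card (nbrs W x)) = (\<Sum>x\<in>?U \<union> ?S. card (nbrs W x))"
    by (rule sum.union_disjoint[symmetric]) (use fins S in auto)
  also have "\<dots> \<le> (\<Sum>x\<in>X. card (nbrs W x))"
    by (rule sum_mono2) (use finX S in auto)
  also have "\<dots> = 2 * card W" by (rule handshake[OF finX W_sub])
  finally show ?thesis using 1 2 by linarith
qed

text \<open>A point outside the nonperfect blocks with degree \<open>d\<close> in \<open>W\<close>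
  allows \<open>bound_if_low_degree\<close>. Without one, \<open>edges_ge\<close> at a point of at
  most average degree in \<open>H\<close> makes \<open>W\<close> too large, by
  \<open>large_order_contradiction\<close>.\<close>

lemma steiner_bound:
  assumes d1: "d \<ge> 1" and v1: "3 * d * (q * (q + 1)) \<le> card X"
    and v2: "12 * d\<^sup>2 + 10 * d + 2 + 3 * d * (1 + 2 * d) * (q + 1 + d) \<le> 2 * card X"
  shows "q * (q + 1) * card G \<le> (card X - d) * (card X - d - 1)"
proof (cases "\<exists>u\<in>X - \<Union>NP. card (nbrs W u) = d")
  case True
  have "card X > d + 1" using v2 d1 by (cases d) auto
  then show ?thesis using True bound_if_low_degree by blast
next
  case False
  show ?thesis
  proof (rule ccontr)
    assume large: "\<not> ?thesis"
    let ?v = "card X" and ?k = "q + 1 + d"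
    have vpos: "?v > d + 1" using v2 d1 by (cases d) auto
    obtain m where m: "2 * m = q * (q + 1)"
      by (metis even_mult_iff even_plus_one_iff dvdE)
    \<comment> \<open>The total excess over the minimum \<open>m\<close> of own pairs per block.
      Each nonperfect block contributes at least 1, so \<open>E\<close> also bounds their
      number.\<close>
    define E where "E = (\<Sum>B\<in>G. card (own B) - m)"
    have own_m: "m \<le> card (own B)" if "B \<in> G" for B using own_card(1)[OF that] m by simp
    have ownE: "(\<Sum>B\<in>G. card (own B)) = m * card G + E"
    proof -
      have "(\<Sum>B\<in>G. card (own B)) = (\<Sum>B\<in>G. m + (card (own B) - m))"
        using own_m by (intro sum.cong) auto
      then show ?thesis by (simp add: sum.distrib E_def)
    qed
    have total: "2 * card W + 2 * m * card G + 2 * E = ?v * (?v - 1)"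
      using W_count ownE two_choose_two[of ?v] by simp
    have finNP: "finite NP" using finG NP_G by (rule finite_subset[rotated])
    have pE: "card NP \<le> E"
    proof -
      have "card NP = (\<Sum>B\<in>NP. 1)" by simp
      also have "\<dots> \<le> (\<Sum>B\<in>NP. card (own B) - m)"
      proof (rule sum_mono)
        fix B assume "B \<in> NP"
        then have "B \<in> G" "card (own B) \<noteq> m" using m by (auto simp: NP_def)
        then show "1 \<le> card (own B) - m" using own_m[of B] by simp
      qed
      also have "\<dots> \<le> E" unfolding E_def by (rule sum_mono2[OF finG NP_G]) auto
      finally show ?thesis .
    qed
    have NPown: "(\<Sum>B\<in>NP. card (own B)) \<le> m * E + E"
    proof -
      have "(\<Sum>B\<in>NP. card (own B)) = (\<Sum>B\<in>NP. m + (card (own B) - m))"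
        using own_m NP_G by (intro sum.cong) auto
      also have "\<dots> = m * card NP + (\<Sum>B\<in>NP. card (own B) - m)"
        by (simp add: sum.distrib)
      also have "\<dots> \<le> m * E + E"
        unfolding E_def by (intro add_mono mult_le_mono2 pE[unfolded E_def] sum_mono2[OF finG NP_G]) auto
      finally show ?thesis .
    qed
    have cardH: "card H \<le> card W + m * E + E"
    proof -
      have "card (\<Union>(own ` NP)) \<le> (\<Sum>B\<in>NP. card (own B))" by (rule card_UN_le[OF finNP])
      then show ?thesis
        using card_Un_le[of W "\<Union>(own ` NP)"] NPown unfolding H_def by linarith
    qed
    have "\<exists>z\<in>X. ?v * card (nbrs H z) \<le> 2 * card H"
    proof (rule ccontr)
      assume "\<not> ?thesis"
      then have "\<And>z. z \<in> X \<Longrightarrow> 2 * card H < ?v * card (nbrs H z)" by auto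
      moreover have "X \<noteq> {}" using vpos by auto
      ultimately have "(\<Sum>z\<in>X. 2 * card H) < (\<Sum>z\<in>X. ?v * card (nbrs H z))"
        using finX by (intro sum_strict_mono) auto
      then show False
        using handshake[OF finX H_sub] by (simp add: sum_distrib_left[symmetric])
    qed
    then obtain z where z: "z \<in> X" "?v * card (nbrs H z) \<le> 2 * card H" by blast
    define s where "s = card (nbrs H z)"
    let ?U = "X - {z} - nbrs H z"
    have cU: "card ?U + 1 + s = ?v"
    proof -
      have "z \<notin> nbrs H z" by (simp add: nbrs_def)
      then have ins: "card (insert z (nbrs H z)) = 1 + s"
        using finite_nbrs(2) by (simp add: s_def)
      have sub: "insert z (nbrs H z) \<subseteq> X" using z(1) nbrs_subset[OF H_sub] by blast
      have "card (X - insert z (nbrs H z)) = ?v - (1 + s)"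
        using card_Diff_subset[OF _ sub] finite_nbrs(2) ins by simp
      moreover have "X - insert z (nbrs H z) = ?U" by auto
      moreover have "1 + s \<le> ?v" using card_mono[OF finX sub] ins by simp
      ultimately show ?thesis by simp
    qed
    have NPpts: "card ?U \<le> card (?U - \<Union>NP) + E * ?k"
    proof -
      have "card (\<Union>NP) \<le> (\<Sum>B\<in>NP. card B)" by (rule card_Union_le_sum_card_weak) (use finB NP_G in blast)
      also have "\<dots> = card NP * ?k" using card_block NP_G by (simp add: subset_iff)
      also have "\<dots> \<le> E * ?k" using pE by (rule mult_le_mono1)
      finally have "card (\<Union>NP) \<le> E * ?k" .
      moreover have "card ?U \<le> card (?U - \<Union>NP) + card (\<Union>NP)"
        using diff_card_le_card_Diff[of "\<Union>NP" ?U] finNP finB NP_G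
        by (metis (no_types, lifting) finite_Union le_diff_conv subset_iff)
      ultimately show ?thesis by linarith
    qed
    have eW: "2 * d * card ?U + card (?U - \<Union>NP) \<le> 2 * card W"
      by (rule edges_ge[OF z(1)]) (use False in blast)
    have "(?v - d) * (?v - d - 1) < 2 * m * card G" using large m by simp
    have "(int ?v - int d) * (int ?v - int d - 1) < int (2 * m * card G)"
    proof -
      have "int ((?v - d) * (?v - d - 1)) = (int ?v - int d) * (int ?v - int d - 1)"
        using vpos by (simp add: of_nat_diff)
      then show ?thesis using \<open>(?v - d) * (?v - d - 1) < 2 * m * card G\<close> by linarith
    qed
    then show False
    proof (rule large_order_contradiction[rotated])
      have "int (2 * card W + 2 * m * card G + 2 * E) = int (?v * (?v - 1))" using total by simp
      then show "2 * int (card W) + int (2 * m * card G) + 2 * int E = int ?v * (int ?v - 1)"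
        using vpos by (simp add: of_nat_diff)
      show "int ?v * int s \<le> 2 * (int (card W) + int m * int E + int E)"
      proof -
        have "?v * s \<le> 2 * (card W + m * E + E)" using z(2) cardH by (simp add: s_def)
        then have "int (?v * s) \<le> int (2 * (card W + m * E + E))" by (simp only: of_nat_le_iff)
        then show ?thesis by (simp only: of_nat_add of_nat_mult of_nat_numeral of_nat_power of_nat_1)
      qed
      show "int (card ?U) + 1 + int s = int ?v" using cU by linarith
      show "int (card ?U) \<le> int (card (?U - \<Union>NP)) + int E * int ?k"
      proof -
        have "int (card ?U) \<le> int (card (?U - \<Union>NP) + E * ?k)" using NPpts by (simp only: of_nat_le_iff)
        then show ?thesis by (simp only: of_nat_add of_nat_mult of_nat_numeral of_nat_power of_nat_1)
      qed
      show "2 * int d * int (card ?U) + int (card (?U - \<Union>NP)) \<le> 2 * int (card W)"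
      proof -
        have "int (2 * d * card ?U + card (?U - \<Union>NP)) \<le> int (2 * card W)" using eW by (simp only: of_nat_le_iff)
        then show ?thesis by (simp only: of_nat_add of_nat_mult of_nat_numeral of_nat_power of_nat_1)
      qed
      show "3 * int d * (2 * int m) \<le> int ?v"
      proof -
        have "int (3 * d * (2 * m)) \<le> int ?v" using v1 unfolding m[symmetric] by (simp only: of_nat_le_iff)
        then show ?thesis by (simp only: of_nat_add of_nat_mult of_nat_numeral of_nat_power of_nat_1)
      qed
      show "12 * (int d)\<^sup>2 + 10 * int d + 2 + 3 * int d * (1 + 2 * int d) * int ?k \<le> 2 * int ?v"
      proof -
        have "int (12 * d\<^sup>2 + 10 * d + 2 + 3 * d * (1 + 2 * d) * ?k) \<le> int (2 * ?v)"
          using v2 by (simp only: of_nat_le_iff)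
        then show ?thesis by (simp only: of_nat_add of_nat_mult of_nat_numeral of_nat_power of_nat_1)
      qed
    qed (use d1 vpos in auto)
  qed
qed

end

text \<open>Set aside the \<open>y\<close> blocks having a point in no other block, each with one
  such point; these points are distinct and lie in no remaining block. For \<open>y > 2 * d\<close>
  the estimate \<open>plain_bound\<close> is good enough, otherwise the order is still large enough
  for \<open>steiner_bound\<close> (\<open>plain_bound\<close> if \<open>d = 0\<close>). The removal
  bounds account for the \<open>y\<close> blocks.\<close>

theorem cover_free_bound:
  fixes F :: "'a set set" and q d v :: nat
  assumes cf: "cover_free q F" and X: "finite X" "card X = v"
    and F: "\<And>B. B \<in> F \<Longrightarrow> B \<subseteq> X \<and> card B = q + 1 + d"
    and q: "q \<ge> 4" and dq: "3 * d + 2 \<le> 2 * q"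
    and v: "q ^ (2 + min 2 d) + q + 1 + d \<le> v"
  shows "q * (q + 1) * card F \<le> (v - d) * (v - d - 1)"
proof -
  have finF: "finite F" by (rule finite_subset[of _ "Pow X"]) (use F X in auto)
  define F0 where "F0 = {B \<in> F. \<exists>x\<in>B. \<forall>B'\<in>F - {B}. x \<notin> B'}"
  define p where "p B = (SOME x. x \<in> B \<and> (\<forall>B'\<in>F - {B}. x \<notin> B'))" for B
  have p: "p B \<in> B \<and> (\<forall>B'\<in>F - {B}. p B \<notin> B')" if "B \<in> F0" for B
    unfolding p_def by (rule someI_ex) (use that in \<open>auto simp: F0_def\<close>)
  have F0: "F0 \<subseteq> F" by (auto simp: F0_def)
  have "inj_on p F0"
  proof (rule inj_onI, rule ccontr)
    fix B B' assume B: "B \<in> F0" "B' \<in> F0" "p B = p B'" "B \<noteq> B'"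
    then have "B' \<in> F - {B}" using F0 by blast
    then have "p B \<notin> B'" using p[OF B(1)] by blast
    then show False using p[OF B(2)] B(3) by simp
  qed
  then have cY: "card (p ` F0) = card F0" by (rule card_image)
  have YX: "p ` F0 \<subseteq> X" using p F F0 by blast
  define y where "y = card F0"
  let ?G = "F - F0" and ?X = "X - p ` F0"
  have cX: "card ?X = v - y"
    using card_Diff_subset[OF finite_subset[OF YX X(1)] YX] cY X(2) by (simp add: y_def)
  have yv: "y \<le> v" using card_mono[OF X(1) YX] cY X(2) by (simp add: y_def)
  have cF: "card F = y + card ?G"
    using card_Diff_subset[OF finite_subset[OF F0 finF] F0] card_mono[OF finF F0] by (simp add: y_def)
  interpret cover_free_blocks F ?G ?X q d
  proof
    show "B \<subseteq> ?X" if B: "B \<in> ?G" for B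
    proof -
      have "p B0 \<notin> B" if "B0 \<in> F0" for B0 using p[OF that] B that by blast
      then show ?thesis using F[of B] B by blast
    qed
    show "\<exists>B'\<in>F - {B}. x \<in> B'" if "B \<in> ?G" "x \<in> B" for B x
      using that unfolding F0_def by blast
    show "card B = q + 1 + d" if "B \<in> ?G" for B using F that by blast
  qed (use cf finF X(1) dq in auto)
  have qq: "q * (q + 1) + 1 + d \<le> v" "d \<ge> 1 \<Longrightarrow> 2 * (q * (q + 1)) + d + 1 \<le> v"
  proof -
    have "q ^ 2 \<le> q ^ (2 + min 2 d)" using q by (intro power_increasing) auto
    then have "q ^ 2 + q + 1 + d \<le> v" using v by linarith
    then show "q * (q + 1) + 1 + d \<le> v" by (simp add: power2_eq_square)
    assume "d \<ge> 1"
    then have "q ^ 3 \<le> q ^ (2 + min 2 d)" using q by (intro power_increasing) auto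
    moreover have "2 * (q * (q + 1)) \<le> q ^ 3"
    proof -
      obtain r where "q = r + 4" using q by (metis add.commute le_Suc_ex)
      then show ?thesis by (simp add: power3_eq_cube algebra_simps)
    qed
    ultimately show "2 * (q * (q + 1)) + d + 1 \<le> v" using v by linarith
  qed
  have split: "q * (q + 1) * (y + card ?G) = q * (q + 1) * y + q * (q + 1) * card ?G"
    by (rule add_mult_distrib2)
  have plain: "q * (q + 1) * card ?G \<le> (v - y) * (v - y - 1)"
    using plain_bound unfolding cX .
  show ?thesis
  proof (cases "2 * d < y \<and> d \<ge> 1")
    case True
    then have "q * (q + 1) * y + (v - y) * (v - y - 1) \<le> (v - d) * (v - d - 1)"
      using quadratic_removal_bound'[of d y v "q * (q + 1)"] yv qq(2) by simp
    then show ?thesis using plain unfolding cF split by linarith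
  next
    case False
    have "q * (q + 1) * card ?G \<le> (v - d - y) * (v - d - y - 1)"
    proof (cases "d = 0")
      case True
      then show ?thesis using plain by simp
    next
      case d: False
      then have "y \<le> 2 * d" using False by simp
      \<comment> \<open>The summand \<open>q + 1 + d\<close> in the bound on \<open>v\<close> makes
        up for at most \<open>2 * d\<close> lost points.\<close>
      then have "q ^ (2 + min 2 d) \<le> v - y" using v dq by linarith
      then have "q * (q + 1) * card ?G \<le> (card ?X - d) * (card ?X - d - 1)"
        using large_order_conditions[OF q _ dq] d cX by (intro steiner_bound) auto
      then show ?thesis unfolding cX by (simp add: add.commute)
    qed
    moreover have "q * (q + 1) * y + (v - d - y) * (v - d - y - 1) \<le> (v - d) * (v - d - 1)"
    proof (rule quadratic_removal_bound)
      show "q * (q + 1) + 1 \<le> v - d" using qq(1) by linarith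
      show "y \<le> v - d"
      proof (cases "d = 0")
        case True
        then show ?thesis using yv by simp
      next
        case d: False
        then show ?thesis using False qq(2) dq by simp
      qed
    qed
    ultimately show ?thesis unfolding cF split by linarith
  qed
qed

section \<open>Optimal schemes\<close>

text \<open>The pairs of points are covered by the pairs on the lines. This bounds the number of
  blocks of the construction from below; the general upper bound then yields equality.\<close>

lemma linear_space_card:
  assumes L: "linear_space k P \<L>"
  shows "card P * (card P - 1) \<le> k * (k - 1) * card \<L>"
proof -
  have P: "finite P" "\<L> \<subseteq> [P]\<^bsup>k\<^esup>"
    and ex: "\<And>x y. x \<in> P \<Longrightarrow> y \<in> P \<Longrightarrow> x \<noteq> y \<Longrightarrow> \<exists>!l. l \<in> \<L> \<and> x \<in> l \<and> y \<in> l"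
    using L unfolding linear_space_def by blast+
  have finL: "finite \<L>"
    using P(2) finite_imp_finite_nsets[OF P(1)] by (rule finite_subset)
  have "[P]\<^bsup>2\<^esup> \<subseteq> (\<Union>l\<in>\<L>. [l]\<^bsup>2\<^esup>)"
  proof
    fix e assume e: "e \<in> [P]\<^bsup>2\<^esup>"
    then obtain x y where xy: "e = {x, y}" "x \<noteq> y" "x \<in> P" "y \<in> P"
      by (auto simp: nsets_def card_2_iff)
    then obtain l where "l \<in> \<L>" "x \<in> l" "y \<in> l" using ex by blast
    then show "e \<in> (\<Union>l\<in>\<L>. [l]\<^bsup>2\<^esup>)" using xy by (auto simp: nsets_def)
  qed
  then have "card ([P]\<^bsup>2\<^esup>) \<le> card (\<Union>l\<in>\<L>. [l]\<^bsup>2\<^esup>)"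
    by (rule card_mono[rotated]) (use finL P(2) in \<open>auto simp: nsets_def\<close>)
  also have "\<dots> \<le> (\<Sum>l\<in>\<L>. card ([l]\<^bsup>2\<^esup>))" by (rule card_UN_le[OF finL])
  also have "\<dots> = (\<Sum>l\<in>\<L>. k choose 2)"
  proof (intro sum.cong refl)
    fix l assume "l \<in> \<L>"
    then have "card l = k" using P(2) by (auto simp: nsets_def)
    then show "card ([l]\<^bsup>2\<^esup>) = k choose 2" by (simp add: card_nsets)
  qed
  finally have "2 * (card P choose 2) \<le> 2 * (k choose 2) * card \<L>"
    by (simp add: card_nsets mult.commute)
  then show ?thesis unfolding two_choose_two .
qed

lemma inj_on_Plus: "inj_on (\<lambda>l. l <+> D) A"
proof (rule inj_on_inverseI)
  show "Inl -` (l <+> D) = l" for l by auto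
qed

text \<open>Every set \<open>T\<close> of at least \<open>t\<^sup>2 + 1\<close> points on \<open>t\<close> lines meets one of them in more than \<open>t\<close> points,
  and any further line in at most \<open>t\<close>.  Points common to all the blocks change no comparison.\<close>

lemma linear_space_imp_TS:
  assumes L: "linear_space (t\<^sup>2 + 1) P \<L>"
  shows "traceability_scheme t (t\<^sup>2 + d + 1) (card P + d) (P <+> {..<d}) ((\<lambda>l. l <+> {..<d}) ` \<L>)"
  unfolding traceability_scheme_def
proof (intro conjI allI impI)
  let ?\<phi> = "\<lambda>l. l <+> {..<d}"
  have P: "finite P" "\<L> \<subseteq> nsets P (t\<^sup>2 + 1)"
    and ex: "\<And>x y. x \<in> P \<Longrightarrow> y \<in> P \<Longrightarrow> x \<noteq> y \<Longrightarrow> \<exists>!l. l \<in> \<L> \<and> x \<in> l \<and> y \<in> l"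
    using L unfolding linear_space_def by blast+
  have l: "l \<subseteq> P" "finite l" "card l = t\<^sup>2 + 1" if "l \<in> \<L>" for l
    using that P(2) by (auto simp: nsets_def)
  have meet: "card (l \<inter> l') \<le> 1" if "l \<in> \<L>" "l' \<in> \<L>" "l \<noteq> l'" for l l'
  proof -
    have "x = y" if "x \<in> l \<inter> l'" "y \<in> l \<inter> l'" for x y
      using ex[of x y] that l \<open>l \<in> \<L>\<close> \<open>l' \<in> \<L>\<close> \<open>l \<noteq> l'\<close> by blast
    then show ?thesis using l(2)[OF that(1)] by (simp add: card_le_Suc0_iff_eq)
  qed
  show "finite (P <+> {..<d})" using P(1) by simp
  show "card (P <+> {..<d}) = card P + d" using P(1) by (simp add: card_Plus)
  show "?\<phi> ` \<L> \<subseteq> nsets (P <+> {..<d}) (t\<^sup>2 + d + 1)"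
    using l by (auto simp: nsets_def card_Plus)
  fix S T
  assume ST: "S \<subseteq> ?\<phi> ` \<L> \<and> 1 \<le> card S \<and> card S \<le> t \<and> T \<in> nsets (\<Union>S) (t\<^sup>2 + d + 1)"
  have inj: "inj_on ?\<phi> \<L>" by (rule inj_on_Plus)
  obtain S' where S': "S' \<subseteq> \<L>" "S = ?\<phi> ` S'" using ST by (auto simp: subset_image_iff)
  have cS': "card S' = card S" using inj S' by (metis card_image inj_on_subset)
  have finS': "finite S'" using cS' ST by (metis card.infinite not_one_le_zero)
  have finT: "finite T" and cT: "card T = t\<^sup>2 + d + 1" and TS: "T \<subseteq> \<Union>S"
    using ST by (auto simp: nsets_def)
  define A where "A = Inl -` T"
  define C where "C = Inr -` T"
  have T: "T = A <+> C" 
  proof (rule Set.set_eqI)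
    show "x \<in> T \<longleftrightarrow> x \<in> A <+> C" for x by (cases x) (auto simp: A_def C_def)
  qed
  have finA: "finite A" "finite C" using finT unfolding T by auto
  have C: "C \<subseteq> {..<d}" and A: "A \<subseteq> \<Union>S'"
    using TS unfolding T S'(2) by auto
  have "card A + card C = t\<^sup>2 + d + 1" using cT finA unfolding T by (simp add: card_Plus)
  moreover have "card C \<le> d" using card_mono[OF _ C] by simp
  \<comment> \<open>At most \<open>d\<close> points of \<open>T\<close> are common points, so at
    least \<open>t\<^sup>2 + 1\<close> lie in the linear space.\<close>
  ultimately have cA: "card A \<ge> t\<^sup>2 + 1" by simp
  have cap: "card (T \<inter> ?\<phi> l) = card (A \<inter> l) + card C" for l
  proof -
    have "T \<inter> ?\<phi> l = (A \<inter> l) <+> C" using C unfolding T by auto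
    then show ?thesis using finA by (simp add: card_Plus)
  qed
  show "\<not> (\<exists>B\<in>?\<phi> ` \<L> - S. \<forall>B'\<in>S. card (T \<inter> B') \<le> card (T \<inter> B))"
  proof
    assume "\<exists>B\<in>?\<phi> ` \<L> - S. \<forall>B'\<in>S. card (T \<inter> B') \<le> card (T \<inter> B)"
    then obtain l0 where l0: "l0 \<in> \<L>" "?\<phi> l0 \<notin> S"
      and le': "\<forall>B'\<in>S. card (T \<inter> B') \<le> card (T \<inter> ?\<phi> l0)" by blast
    have l0S': "l0 \<notin> S'" using l0(2) S'(2) by blast
    have le: "card (A \<inter> l) \<le> card (A \<inter> l0)" if "l \<in> S'" for l
    proof -
      have "card (T \<inter> ?\<phi> l) \<le> card (T \<inter> ?\<phi> l0)" using le' that S'(2) by blast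
      then show ?thesis unfolding cap by simp
    qed
    have "card (A \<inter> l0) \<le> card (\<Union>l\<in>S'. l0 \<inter> l)"
      by (rule card_mono) (use A finS' l(2)[OF l0(1)] in auto)
    also have "\<dots> \<le> (\<Sum>l\<in>S'. card (l0 \<inter> l))" by (rule card_UN_le[OF finS'])
    also have "\<dots> \<le> (\<Sum>l\<in>S'. 1)"
    proof (rule sum_mono)
      fix l assume "l \<in> S'"
      then show "card (l0 \<inter> l) \<le> 1" using l0(1) l0S' S'(1) by (intro meet) auto
    qed
    also have "\<dots> \<le> t" using cS' ST by simp
    finally have At: "card (A \<inter> l0) \<le> t" .
    have "card A \<le> card (\<Union>l\<in>S'. A \<inter> l)"
      by (rule card_mono) (use A finS' finA in auto)
    also have "\<dots> \<le> (\<Sum>l\<in>S'. card (A \<inter> l))" by (rule card_UN_le[OF finS'])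
    also have "\<dots> \<le> (\<Sum>l\<in>S'. t)" by (intro sum_mono le_trans[OF le At])
    also have "\<dots> \<le> t * t" using cS' ST by simp
    finally show False using cA by (simp add: power2_eq_square)
  qed
qed

text \<open>Squares are 0 or 1 modulo 3. This rules out 3d + 1 = 2t^2 and so sharpens 3d < 2t^2 to
  the bound that \<open>erdos_gallai\<close> requires.\<close>

lemma not_three_dvd_square_plus_one: "\<not> 3 dvd t\<^sup>2 + (1::nat)"
proof -
  have "t mod 3 = 0 \<or> t mod 3 = 1 \<or> t mod 3 = 2" by presburger
  moreover have "(t\<^sup>2 + 1) mod 3 = ((t mod 3)\<^sup>2 + 1) mod 3"
    by (metis mod_add_left_eq power_mod)
  ultimately have "(t\<^sup>2 + 1) mod 3 \<noteq> 0" by (auto simp: power2_eq_square)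
  then show ?thesis by (simp add: dvd_eq_mod_eq_0)
qed

theorem theoremV4:
  fixes t d n w v :: nat
  assumes "primepow t"
    and "int d < \<lceil>2 * real t ^ 2 / 3\<rceil>"
    and "n \<ge> 2 + min 2 d"
    and "w = t ^ 2 + d + 1"
    and "v = (\<Sum>i=1..n. t ^ (2 * i)) + d + 1"
  shows "\<exists>(X :: nat set) \<B>. optimal_TS t w v X \<B> \<and>
           real (card \<B>) =
             real ((v - d) choose nat \<lceil>real w / real (t ^ 2)\<rceil>) /
             real ((w - d) choose nat \<lceil>real w / real (t ^ 2)\<rceil>)"
proof -
  define q where "q = t\<^sup>2"
  have "t \<ge> 2" using primepow_gt_Suc_0[OF assms(1)] by simp
  then have q4: "q \<ge> 4" using power_mono[of 2 t 2] by (simp add: q_def)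
  have "real d < 2 * real t ^ 2 / 3" using assms(2) by (simp add: less_ceiling_iff)
  then have "real (3 * d) < real (2 * q)" by (simp add: q_def)
  then have "3 * d < 2 * q" by (simp only: of_nat_less_iff)
  moreover have "3 * d + 1 \<noteq> 2 * q"
  proof
    assume "3 * d + 1 = 2 * q"
    then have "3 dvd t\<^sup>2 + 1" unfolding q_def[symmetric] by presburger
    then show False using not_three_dvd_square_plus_one by blast
  qed
  ultimately have dq: "3 * d + 2 \<le> 2 * q" by linarith
  have w: "w = q + d + 1" using assms(4) by (simp add: q_def)
  \<comment> \<open>The bound on \<open>d\<close> gives \<open>d + 1 \<le> q\<close>, so
    \<open>w\<close> lies above \<open>q\<close> and at most at \<open>2 * q\<close>.\<close>
  have ceil: "nat \<lceil>real w / real (t ^ 2)\<rceil> = 2"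
  proof -
    have "\<lceil>real w / real q\<rceil> = 2"
    proof (rule ceiling_unique)
      show "real_of_int 2 - 1 < real w / real q" using q4 w by (simp add: field_simps)
      have "d + 1 \<le> q" using dq q4 by linarith
      then have "w \<le> 2 * q" using w by simp
      then have "real w \<le> real (2 * q)" by (simp only: of_nat_le_iff)
      then show "real w / real q \<le> real_of_int 2" using q4 by (simp add: field_simps)
    qed
    then show ?thesis by (simp add: q_def)
  qed
  define N where "N = (\<Sum>i\<le>n. q ^ i)"
  have v: "v = N + d"
  proof -
    have "(\<Sum>i\<le>n. q ^ i) = 1 + (\<Sum>i=1..n. q ^ i)"
      by (simp add: atMost_atLeast0 sum.atLeast_Suc_atMost)
    moreover have "q ^ i = t ^ (2 * i)" for i by (simp add: q_def power_mult)
    ultimately show ?thesis unfolding N_def assms(5) by simp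
  qed
  have vlarge: "q ^ (2 + min 2 d) + q + 1 + d \<le> v"
  proof -
    \<comment> \<open>These exponents are distinct and at most \<open>n\<close>; their three powers
      already give the order needed for the upper bound.\<close>
    have "(\<Sum>i\<in>{0, 1, 2 + min 2 d}. q ^ i) \<le> N"
      unfolding N_def by (rule sum_mono2) (use assms(3) in auto)
    then show ?thesis unfolding v by simp
  qed
  have bound: "q * (q + 1) * card \<B> \<le> N * (N - 1)"
    if TS: "traceability_scheme t w v X \<B>" for X :: "nat set" and \<B>
  proof -
    have "q * (q + 1) * card \<B> \<le> (v - d) * (v - d - 1)"
    proof (rule cover_free_bound[OF _ TS_D(1,2)[OF TS] _ q4 dq vlarge])
      show "cover_free q \<B>" unfolding q_def by (rule TS_imp_cover_free[OF TS]) (simp add: w)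
      show "B \<subseteq> X \<and> card B = q + 1 + d" if "B \<in> \<B>" for B
        using TS_D(3)[OF TS that] w by simp
    qed
    then show ?thesis unfolding v by simp
  qed
  have "primepow q" unfolding q_def using assms(1) \<open>t \<ge> 2\<close> by (simp add: primepow_power_iff_nat)
  then obtain P :: "(((int list \<times> nat) multiset \<Rightarrow> int) set) set" and \<L>
    where L: "linear_space (q + 1) P \<L>" and cP: "card P = N"
    unfolding N_def by (rule ex_projective_space)
  let ?B = "(\<lambda>l. l <+> {..<d}) ` \<L>"
  have TS0: "traceability_scheme t w v (P <+> {..<d}) ?B"
    using linear_space_imp_TS[of t P \<L> d] L unfolding q_def[symmetric] w v cP .
  have "finite (P <+> {..<d})" using TS_D(1)[OF TS0] .
  \<comment> \<open>The points are renamed as natural numbers, over which the maximum is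
    defined.\<close>
  then obtain f :: "_ \<Rightarrow> nat" where f: "inj_on f (P <+> {..<d})"
    by (metis finite_imp_inj_to_nat_seg)
  define X where "X = f ` (P <+> {..<d})"
  define \<B> where "\<B> = (`) f ` ?B"
  have TS: "traceability_scheme t w v X \<B>" and cB: "card \<B> = card \<L>"
  proof -
    show "traceability_scheme t w v X \<B>"
      unfolding X_def \<B>_def by (rule traceability_scheme_image(1)[OF TS0 f])
    have "inj_on (\<lambda>l. l <+> {..<d}) \<L>" by (rule inj_on_Plus)
    then show "card \<B> = card \<L>"
      unfolding \<B>_def traceability_scheme_image(2)[OF TS0 f] by (rule card_image)
  qed
  have lower: "N * (N - 1) \<le> q * (q + 1) * card \<B>"
    using linear_space_card[OF L] unfolding cP cB by (simp add: mult.commute)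
  \<comment> \<open>The construction attains the upper bound, so no scheme with these parameters is
    larger.\<close>
  have eq: "q * (q + 1) * card \<B> = N * (N - 1)"
    using bound[OF TS] lower by (rule le_antisym)
  have "card \<B> = max_TS_size t w v"
    unfolding max_TS_size_def
  proof (rule Max_eqI[symmetric, OF max_TS_size_set(1)])
    show "card \<B> \<in> {card \<B> |\<B>. \<exists>X :: nat set. traceability_scheme t w v X \<B>}"
      using TS by blast
    fix c assume "c \<in> {card \<B> |\<B>. \<exists>X :: nat set. traceability_scheme t w v X \<B>}"
    then obtain X' :: "nat set" and \<C> where "c = card \<C>" "traceability_scheme t w v X' \<C>" by blast
    then have "q * (q + 1) * c \<le> q * (q + 1) * card \<B>" using bound eq by simp
    then show "c \<le> card \<B>" using q4 by simp
  qed
  then have "optimal_TS t w v X \<B>" using TS by (simp add: optimal_TS_def)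
  moreover have "real (card \<B>) = real ((v - d) choose 2) / real ((w - d) choose 2)"
  proof -
    have "2 * ((v - d) choose 2) = 2 * ((w - d) choose 2) * card \<B>"
      unfolding two_choose_two using eq v w by (simp add: mult.commute)
    then have "real ((v - d) choose 2) = real ((w - d) choose 2) * real (card \<B>)"
      by (simp flip: of_nat_mult)
    moreover have "(w - d) choose 2 > 0" using w q4 by (intro zero_less_binomial) simp
    ultimately show ?thesis by (simp add: field_simps)
  qed
  ultimately show ?thesis unfolding ceil by blast
qed

end
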